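(* Let $n\ge 2$ and let $\Sigma=(B,\mathbf p,\mathbf x)$ and $\Sigma^*=(B^*,\mathbf p^*,\mathbf x^* )$ be non-normalized seeds of rank $n$ in the same ambient field $\mathcal F$ with coefficient group $\mathbf P$, where $B=(b_{ij})$, $\mathbf x=(x_i)$, $\mathbf p=(p_i^{\pm})$, $\mathbf x^*=(x_i^* )$, $\mathbf p^*=((p^* )_i^{\pm})$. The following are equivalent: (1) $\Sigma\sim\Sigma^*$, i.e. there is a contractible sequence of mutations from $\Sigma$ to $\Sigma^*$; (2) $B=B^*$, $\hat{\mathbf y}(\Sigma)=\hat{\mathbf y}(\Sigma^* )$, and $x_i\asymp x_i^*$ for all $i$; (3) $B=B^*$ and there exist $c_1,\dots,c_n,d_1,\dots,d_n\in\mathbf P$ such that for all $j$ $$x_j^*=\frac{x_j}{c_j},\qquad (p^* )^{\pm}_j=\frac{p_j^{\pm}}{d_j}\prod_{i=1}^n c_i^{[\pm b_{ij}]_+}.$$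
   Context: Notation: $[x]_+=\max(x,0)$; $\mathrm{sign}(x)\in\{-1,0,1\}$. The coefficient group $\mathbf P$ is a torsion-free abelian multiplicative group, and the ambient field $\mathcal F$ is a field of rational functions in $n$ variables with coefficients in $\mathbf P$ (i.e. over the fraction field of the group ring $\mathbb Q\mathbf P$). A non-normalized seed of rank $n$ in $\mathcal F$ is a triple $\Sigma=(B,\mathbf p,\mathbf x)$ where $B=(b_{ij})$ is a skew-symmetrizable $n\times n$ integer matrix, $\mathbf p=(p_1^{\pm},\dots,p_n^{\pm})$ consists of $2n$ elements of $\mathbf P$, and $\mathbf x=(x_1,\dots,x_n)$ is a tuple of algebraically independent elements freely generating $\mathcal F$ over $\mathbb Q\mathbf P$ (as a field). Two non-normalized seeds $\Sigma=(B,\mathbf p,\mathbf x)$ and $\Sigma'=(B',\mathbf p',\mathbf x')$ are related by a mutation in direction $k\in\{1,\dots,n\}$ if: $b'_{ij}=-b_{ij}$ if $i=k$ or $j=k$, and $b'_{ij}=b_{ij}+\mathrm{sign}(b_{ik})[b_{ik}b_{kj}]_+$ otherwise; $(p')^{\pm}_k=p_k^{\mp}$, and for $j\ne k$: $(p')_j^+/(p')_j^-=(p_j^+/p_j^-)(p_k^+)^{b_{kj}}$ if $b_{kj}\ge0$, and $(p')_j^+/(p')_j^-=(p_j^+/p_j^-)(p_k^-)^{b_{kj}}$ if $b_{kj}\le0$; $x'_j=x_j$ for $j\ne k$ and $x_kx'_k=p_k^+\prod_j x_j^{[b_{jk}]_+}+p_k^-\prod_j x_j^{[-b_{jk}]_+}$.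 This relation is symmetric, but $\Sigma'$ is not uniquely determined by $\Sigma$ and $k$. Let $\mathbb T_n$ be the $n$-regular tree with edges labeled so that the edges at each vertex carry the labels $1,\dots,n$. A sequence $(k_1,\dots,k_\ell)$ in $\{1,\dots,n\}$ is contractible if the walk in $\mathbb T_n$ following edges labeled $k_1,\dots,k_\ell$ returns to its starting vertex. Write $\Sigma\sim\Sigma^*$ if there are a contractible sequence $(k_1,\dots,k_\ell)$ and seeds $\Sigma=\Sigma_0,\Sigma_1,\dots,\Sigma_\ell=\Sigma^*$ such that $\Sigma_{i-1}$ and $\Sigma_i$ are related by a mutation in direction $k_i$ for each $i$. The hatted variables of $\Sigma$ are $\hat{\mathbf y}(\Sigma)=(\hat y_1,\dots,\hat y_n)$ with $\hat y_j=\frac{p_j^+}{p_j^-}\prod_i x_i^{b_{ij}}$. For nonzero $z,x\in\mathcal F$ write $z\asymp x$ if $z/x\in\mathbf P$. *)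

theory Defs
  imports
    "HOL-Analysis.Finite_Cartesian_Product"
    "HOL-Library.Poly_Mapping"
    "HOL.Hull"
begin

text \<open>
  The ambient field is a type \<open>'f\<close> of class \<^class>\<open>field_char_0\<close>, the coefficient group is
  a set \<open>P\<close> of nonzero elements of it, and the index set $\{1,\dots,n\}$ is a finite type \<open>'n\<close>, so that
  $n$ is \<open>CARD('n)\<close>.
\<close>

section \<open>Coefficient group and ambient field\<close>

text \<open>
  A finitely supported function \<open>c\<close> with support in \<open>P\<close> is an element of the group ring over the
  rationals; the following is the canonical map from the group ring to the field.
\<close>

definition group_ring_map :: "('f::field_char_0 \<Rightarrow>\<^sub>0 rat) \<Rightarrow> 'f" where
  "group_ring_map c = (\<Sum>p\<in>Poly_Mapping.keys c. of_rat (Poly_Mapping.lookup c p) * p)"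

text \<open>
  The injectivity requirement says that the group ring is a subring of the field, i.e. that the only
  rational linear relations among elements of \<open>P\<close> are the trivial ones.
\<close>

definition coefficient_group :: "'f::field_char_0 set \<Rightarrow> bool" where
  "coefficient_group P \<longleftrightarrow>
     0 \<notin> P \<and> 1 \<in> P \<and>
     (\<forall>a\<in>P. \<forall>b\<in>P. a * b \<in> P) \<and> (\<forall>a\<in>P. inverse a \<in> P) \<and>
     (\<forall>a\<in>P. \<forall>m>0. a ^ m = 1 \<longrightarrow> a = 1) \<and>
     inj_on group_ring_map {c. Poly_Mapping.keys c \<subseteq> P}"

definition group_ring :: "'f::field_char_0 set \<Rightarrow> 'f set" where
  "group_ring P = group_ring_map ` {c. Poly_Mapping.keys c \<subseteq> P}"

definition group_ring_frac :: "'f::field_char_0 set \<Rightarrow> 'f set" where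
  "group_ring_frac P = {a / b | a b. a \<in> group_ring P \<and> b \<in> group_ring P \<and> b \<noteq> 0}"

definition is_subfield :: "'f::field set \<Rightarrow> bool" where
  "is_subfield K \<longleftrightarrow>
     0 \<in> K \<and> 1 \<in> K \<and>
     (\<forall>a\<in>K. \<forall>b\<in>K. a + b \<in> K \<and> a * b \<in> K) \<and>
     (\<forall>a\<in>K. - a \<in> K \<and> inverse a \<in> K)"

text \<open>
  Polynomials in variables indexed by \<open>'i\<close> are finitely supported functions from
  exponent vectors to coefficients.
\<close>

definition mpoly_eval :: "('i \<Rightarrow> 'f) \<Rightarrow> (('i \<Rightarrow>\<^sub>0 nat) \<Rightarrow>\<^sub>0 'f::field) \<Rightarrow> 'f" where
  "mpoly_eval x q = (\<Sum>m\<in>Poly_Mapping.keys q. Poly_Mapping.lookup q m *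
     (\<Prod>i\<in>Poly_Mapping.keys m. x i ^ Poly_Mapping.lookup m i))"

definition alg_independent :: "'f::field set \<Rightarrow> ('i \<Rightarrow> 'f) \<Rightarrow> bool" where
  "alg_independent K x \<longleftrightarrow>
     (\<forall>q. range (Poly_Mapping.lookup q) \<subseteq> K \<and> mpoly_eval x q = 0 \<longrightarrow> q = 0)"

definition freely_generates :: "'f::field_char_0 set \<Rightarrow> ('i \<Rightarrow> 'f) \<Rightarrow> bool" where
  "freely_generates P x \<longleftrightarrow>
     alg_independent (group_ring_frac P) x \<and>
     is_subfield hull (group_ring P \<union> range x) = UNIV"

definition ambient_field :: "'f::field_char_0 set \<Rightarrow> 'n::finite itself \<Rightarrow> bool" where
  "ambient_field P _ \<longleftrightarrow> coefficient_group P \<and> (\<exists>u :: 'n \<Rightarrow> 'f. freely_generates P u)"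

definition asymp_eq :: "'f::field set \<Rightarrow> 'f \<Rightarrow> 'f \<Rightarrow> bool" where
  "asymp_eq P z x \<longleftrightarrow> z \<noteq> 0 \<and> x \<noteq> 0 \<and> z / x \<in> P"

section \<open>Non-normalized seeds and mutations\<close>

definition pos_part :: "int \<Rightarrow> int" where
  "pos_part b = max b 0"

text \<open>The fields are $B$, $(p_j^+)_j$, $(p_j^-)_j$ and $(x_j)_j$.\<close>

record ('f, 'n) seed =
  exch :: "int ^ 'n ^ 'n"
  coefp :: "'n \<Rightarrow> 'f"
  coefm :: "'n \<Rightarrow> 'f"
  clus :: "'n \<Rightarrow> 'f"

definition skew_symmetrizable :: "int ^ 'n ^ 'n \<Rightarrow> bool" where
  "skew_symmetrizable B \<longleftrightarrow>
     (\<exists>r :: 'n \<Rightarrow> int. (\<forall>i. r i > 0) \<and> (\<forall>i j. r i * B $ i $ j = - (r j * B $ j $ i)))"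

definition is_seed :: "'f::field_char_0 set \<Rightarrow> ('f, 'n::finite) seed \<Rightarrow> bool" where
  "is_seed P S \<longleftrightarrow>
     skew_symmetrizable (exch S) \<and>
     (\<forall>j. coefp S j \<in> P \<and> coefm S j \<in> P) \<and>
     freely_generates P (clus S)"

definition hatted :: "('f::field, 'n::finite) seed \<Rightarrow> 'n \<Rightarrow> 'f" where
  "hatted S j = coefp S j / coefm S j * (\<Prod>i\<in>UNIV. clus S i powi (exch S $ i $ j))"

definition mutation_related ::
    "'n::finite \<Rightarrow> ('f::field, 'n) seed \<Rightarrow> ('f, 'n) seed \<Rightarrow> bool" where
  "mutation_related k S S' \<longleftrightarrow>
     (\<forall>i j. exch S' $ i $ j =
        (if i = k \<or> j = k then - exch S $ i $ j
         else exch S $ i $ j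
              + sgn (exch S $ i $ k) * pos_part (exch S $ i $ k * exch S $ k $ j))) \<and>
     coefp S' k = coefm S k \<and> coefm S' k = coefp S k \<and>
     (\<forall>j. j \<noteq> k \<longrightarrow>
        (exch S $ k $ j \<ge> 0 \<longrightarrow>
           coefp S' j / coefm S' j = coefp S j / coefm S j * coefp S k powi (exch S $ k $ j)) \<and>
        (exch S $ k $ j \<le> 0 \<longrightarrow>
           coefp S' j / coefm S' j = coefp S j / coefm S j * coefm S k powi (exch S $ k $ j))) \<and>
     (\<forall>j. j \<noteq> k \<longrightarrow> clus S' j = clus S j) \<and>
     clus S k * clus S' k =
       coefp S k * (\<Prod>j\<in>UNIV. clus S j powi pos_part (exch S $ j $ k)) +
       coefm S k * (\<Prod>j\<in>UNIV. clus S j powi pos_part (- exch S $ j $ k))"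

section \<open>The labeled regular tree\<close>

text \<open>
  The edge-labeled $n$-regular tree is modelled on the words over \<open>'n\<close> without equal adjacent
  letters; a \<open>k\<close>-labeled edge prepends or removes a leading letter \<open>k\<close>.
  The lemmas below show that this is the tree in question.
\<close>

definition tree_vertices :: "'n list set" where
  "tree_vertices = {v. distinct_adj v}"

definition tree_edge :: "'n \<Rightarrow> 'n list \<Rightarrow> 'n list \<Rightarrow> bool" where
  "tree_edge k v w \<longleftrightarrow>
     v \<in> tree_vertices \<and> w \<in> tree_vertices \<and> (w = k # v \<or> v = k # w)"

fun tree_walk :: "'n list \<Rightarrow> 'n list \<Rightarrow> 'n list \<Rightarrow> bool" where
  "tree_walk [] v w \<longleftrightarrow> v = w"
| "tree_walk (k # ks) v w \<longleftrightarrow> (\<exists>u. tree_edge k v u \<and> tree_walk ks u w)"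

lemma tree_edge_sym: "tree_edge k v w \<longleftrightarrow> tree_edge k w v"
  by (auto simp: tree_edge_def)

lemma tree_edge_ex1:
  assumes "v \<in> tree_vertices"
  shows "\<exists>!w. tree_edge k v w"
proof (cases "\<exists>u. v = k # u")
  case True
  then obtain u where u: "v = k # u" by blast
  have "u \<in> tree_vertices" "k # v \<notin> tree_vertices"
    using assms u by (cases u; auto simp: tree_vertices_def)+
  then show ?thesis
    using assms u by (intro ex1I[of _ u]) (auto simp: tree_edge_def)
next
  case False
  then have "k # v \<in> tree_vertices"
    using assms by (cases v) (auto simp: tree_vertices_def)
  with False show ?thesis
    using assms by (intro ex1I[of _ "k # v"]) (auto simp: tree_edge_def)
qed

lemma tree_walk_append:
  "tree_walk (ks @ ls) v w \<longleftrightarrow> (\<exists>u. tree_walk ks v u \<and> tree_walk ls u w)"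
  by (induction ks arbitrary: v) auto

lemma tree_walk_rev: "tree_walk ks v w \<Longrightarrow> tree_walk (rev ks) w v"
proof (induction ks arbitrary: v)
  case (Cons k ks)
  then show ?case
    by (auto simp: tree_walk_append tree_edge_sym[of k v])
qed auto

lemma tree_walk_to_root: "v \<in> tree_vertices \<Longrightarrow> tree_walk v v []"
proof (induction v)
  case (Cons k v)
  then have "v \<in> tree_vertices"
    by (cases v) (auto simp: tree_vertices_def)
  with Cons show ?case
    by (auto simp: tree_edge_def)
qed auto

lemma tree_connected:
  assumes "v \<in> tree_vertices" "w \<in> tree_vertices"
  shows "\<exists>ks. tree_walk ks v w"
proof -
  have "tree_walk (v @ rev w) v w"
    unfolding tree_walk_append
    using tree_walk_to_root[OF assms(1)] tree_walk_rev[OF tree_walk_to_root[OF assms(2)]] by blast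
  then show ?thesis by blast
qed

lemma tree_walk_nonbacktracking:
  assumes "tree_walk ks v w" "distinct_adj ks"
  shows "\<exists>a b u. ks = a @ b \<and> v = a @ u \<and> w = rev b @ u"
  using assms
proof (induction ks arbitrary: v)
  case Nil
  then show ?case by auto
next
  case (Cons k ks)
  then obtain u where u: "tree_edge k v u" "tree_walk ks u w" by auto
  have "distinct_adj ks" using Cons.prems by (cases ks) auto
  with Cons.IH u(2) obtain a b t where abt: "ks = a @ b" "u = a @ t" "w = rev b @ t"
    by blast
  consider "v = k # u" | "u = k # v" using u(1) by (auto simp: tree_edge_def)
  then show ?case
  proof cases
    case 1
    then have "k # ks = (k # a) @ b \<and> v = (k # a) @ t \<and> w = rev b @ t" using abt by simp
    then show ?thesis by blast
  next
    case 2
    have "a = []"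
      using 2 abt Cons.prems(2) by (cases a) auto
    then have "k # ks = [] @ (k # b) \<and> v = [] @ v \<and> w = rev (k # b) @ v"
      using 2 abt by simp
    then show ?thesis by blast
  qed
qed

lemma tree_acyclic:
  assumes "tree_walk ks v v" "distinct_adj ks"
  shows "ks = []"
proof -
  obtain a b u where abu: "ks = a @ b" "v = a @ u" "v = rev b @ u"
    using tree_walk_nonbacktracking[OF assms] by blast
  then have "ks = a @ rev a" by auto
  with assms(2) show ?thesis
    by (cases a rule: rev_cases) (auto simp: distinct_adj_append_iff)
qed

text \<open>
  Labels determine the neighbour, so a label sequence determines a unique walk from each vertex.
\<close>

definition contractible :: "'n list \<Rightarrow> bool" where
  "contractible ks \<longleftrightarrow> (\<forall>v\<in>tree_vertices. tree_walk ks v v)"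

definition seed_sim ::
    "'f::field_char_0 set \<Rightarrow> ('f, 'n::finite) seed \<Rightarrow> ('f, 'n) seed \<Rightarrow> bool" where
  "seed_sim P S S' \<longleftrightarrow>
     (\<exists>(ks :: 'n list) (T :: nat \<Rightarrow> ('f, 'n) seed).
        contractible ks \<and> T 0 = S \<and> T (length ks) = S' \<and>
        (\<forall>i\<le>length ks. is_seed P (T i)) \<and>
        (\<forall>i<length ks. mutation_related (ks ! i) (T i) (T (Suc i))))"

end

theory Submission
  imports Defs
begin

text \<open>
  Since $x_k x'_k = p_k^- \prod_j x_j^{[-b_{jk}]_+} (1 + \hat y_k)$, a mutation acts on the matrix
  and the hatted variables by formulas in these data alone, and on the cluster up to elements of \<open>P\<close>.
  So condition (2) is an equivalence relation compatible with mutation; as mutation is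
  symmetric, walking to and fro along an edge of the tree returns to the same class.

  Conversely, mutating at $k$ and back by another choice of $\mathbf p'$ rescales the coefficients
  $p_j^\pm$, $j \neq k$, arbitrarily; as $n \ge 2$, a second direction rescales $p_k^\pm$ too.
  Doing so between the two mutations of $k, \dots, k$ rescales $x_k$ and nothing else in the cluster.
  Such moves applied for every $k$ in turn connect any two seeds as in (2).
  That mutation keeps a cluster free reduces to a statement in one variable: if $x$ is transcendental
  over a domain and $a \neq 0$ lies in it, then $a / x$ is transcendental over it.
\<close>

section \<open>Closure of the group ring under sums\<close>

lemma group_ring_map_superset:
  assumes "finite A" "Poly_Mapping.keys c \<subseteq> A"
  shows "group_ring_map c = (\<Sum>p\<in>A. of_rat (Poly_Mapping.lookup c p) * p)"
  unfolding group_ring_map_def using assms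
  by (intro sum.mono_neutral_left) (auto simp: in_keys_iff)

lemma group_ring_map_add: "group_ring_map (c + d) = group_ring_map c + group_ring_map d"
proof -
  let ?A = "Poly_Mapping.keys c \<union> Poly_Mapping.keys d"
  have "Poly_Mapping.keys (c + d) \<subseteq> ?A"
    by (rule Poly_Mapping.keys_add)
  then show ?thesis
    by (simp add: group_ring_map_superset[of ?A] lookup_add of_rat_add distrib_right sum.distrib)
qed

lemma group_ring_add: "a \<in> group_ring P \<Longrightarrow> b \<in> group_ring P \<Longrightarrow> a + b \<in> group_ring P"
  unfolding group_ring_def
  by clarify (metis (no_types, lifting) Poly_Mapping.keys_add Un_least dual_order.trans group_ring_map_add image_eqI mem_Collect_eq)

lemma group_ring_0: "0 \<in> group_ring P"
  unfolding group_ring_def by (rule image_eqI[of _ _ 0]) (auto simp: group_ring_map_def)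

lemma group_ring_sum: "(\<And>i. i \<in> I \<Longrightarrow> f i \<in> group_ring P) \<Longrightarrow> sum f I \<in> group_ring P"
  by (induction I rule: infinite_finite_induct) (auto intro: group_ring_add group_ring_0)

lemma group_ring_single:
  assumes "p \<in> P"
  shows "of_rat r * p \<in> group_ring P"
  unfolding group_ring_def
  by (rule image_eqI[of _ _ "Poly_Mapping.single p r"])
    (use assms in \<open>auto simp: group_ring_map_superset[of "{p}"]\<close>)

section \<open>Algebraic independence\<close>

text \<open>Exponents are plain functions: over a finite index type these are the same as finitely
  supported ones, and changing one exponent becomes an ordinary function update.\<close>

definition monomial_value :: "('n::finite \<Rightarrow> 'f) \<Rightarrow> ('n \<Rightarrow> nat) \<Rightarrow> 'f::field" where
  "monomial_value x m = (\<Prod>i\<in>UNIV. x i ^ m i)"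

lemma monomial_value_add: "monomial_value x (\<lambda>i. m i + l i) = monomial_value x m * monomial_value x l"
  by (simp add: monomial_value_def power_add prod.distrib)

lemma monomial_value_split:
  "monomial_value x m = x k ^ m k * monomial_value x (m(k := 0))"
proof -
  have "(\<Prod>i\<in>UNIV - {k}. x i ^ m i) = (\<Prod>i\<in>UNIV - {k}. x i ^ (m(k := 0)) i)"
    by (rule prod.cong) auto
  then show ?thesis
    unfolding monomial_value_def by (subst (1 2) prod.remove[of _ k]) auto
qed

lemma monomial_value_cong:
  "(\<And>i. i \<noteq> k \<Longrightarrow> x i = y i) \<Longrightarrow> m k = 0 \<Longrightarrow> monomial_value x m = monomial_value y m"
  unfolding monomial_value_def by (rule prod.cong[OF refl]) (metis power_0)

lemma lookup_Abs_finite: "Poly_Mapping.lookup (Abs_poly_mapping f) = (f :: 'n::finite \<Rightarrow> 'a::zero)"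
  by (simp add: lookup_Abs_poly_mapping)

lemma mpoly_eval_eq:
  "mpoly_eval (x :: 'n::finite \<Rightarrow> 'f::field) q =
     (\<Sum>m\<in>Poly_Mapping.keys q. Poly_Mapping.lookup q m * monomial_value x (Poly_Mapping.lookup m))"
  unfolding mpoly_eval_def monomial_value_def
  by (intro sum.cong arg_cong2[where f = "(*)"] refl prod.mono_neutral_left) (auto simp: in_keys_iff)

text \<open>\<open>alg_independent\<close> quantifies over polynomials; this lemma and
  \<open>alg_independentI\<close> trade these for finite families of coefficients, since
  \<open>Poly_Mapping.lookup\<close> is a bijection between the two kinds of exponent
  vectors.\<close>

lemma alg_independentD:
  fixes x :: "'n::finite \<Rightarrow> 'f::field"
  assumes "alg_independent K x" "0 \<in> K" "finite A" "\<And>m. m \<in> A \<Longrightarrow> c m \<in> K"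
    and sum: "(\<Sum>m\<in>A. c m * monomial_value x m) = 0" and "m \<in> A"
  shows "c m = 0"
proof -
  \<comment> \<open>The coefficients are extended by 0 outside \<open>A\<close>, which is where
    \<open>0 \<in> K\<close> enters.\<close>
  let ?c = "\<lambda>m. if Poly_Mapping.lookup m \<in> A then c (Poly_Mapping.lookup m) else 0"
  define q where "q = Abs_poly_mapping ?c"
  have bij: "bij_betw Poly_Mapping.lookup {m :: 'n \<Rightarrow>\<^sub>0 nat. Poly_Mapping.lookup m \<in> A} A"
    by (rule bij_betw_byWitness[where f' = Abs_poly_mapping]) (auto simp: lookup_Abs_finite)
  then have fin: "finite {m :: 'n \<Rightarrow>\<^sub>0 nat. Poly_Mapping.lookup m \<in> A}"
    using assms(3) bij_betw_finite by blast
  have "finite {m. ?c m \<noteq> 0}"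
    by (rule finite_subset[OF _ fin]) auto
  then have lq: "Poly_Mapping.lookup q = ?c"
    unfolding q_def by (simp add: lookup_Abs_poly_mapping)
  have "mpoly_eval x q = (\<Sum>m | Poly_Mapping.lookup m \<in> A.
      c (Poly_Mapping.lookup m) * monomial_value x (Poly_Mapping.lookup m))"
    unfolding mpoly_eval_eq by (intro sum.mono_neutral_cong_left fin) (auto simp: in_keys_iff lq split: if_splits)
  also have "\<dots> = (\<Sum>m\<in>A. c m * monomial_value x m)"
    using bij by (rule sum.reindex_bij_betw)
  finally have "mpoly_eval x q = 0"
    using sum by simp
  moreover have "range (Poly_Mapping.lookup q) \<subseteq> K"
    using assms(2,4) by (auto simp: lq)
  ultimately have "q = 0"
    using assms(1) unfolding alg_independent_def by blast
  moreover have "Poly_Mapping.lookup q (Abs_poly_mapping m) = c m"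
    using \<open>m \<in> A\<close> by (simp add: lq lookup_Abs_finite)
  ultimately show ?thesis by simp
qed

lemma alg_independentI:
  fixes x :: "'n::finite \<Rightarrow> 'f::field"
  assumes "\<And>A c m. finite A \<Longrightarrow> (\<And>m. m \<in> A \<Longrightarrow> c m \<in> K) \<Longrightarrow>
     (\<Sum>m\<in>A. c m * monomial_value x m) = 0 \<Longrightarrow> m \<in> A \<Longrightarrow> c m = 0"
  shows "alg_independent K x"
  unfolding alg_independent_def
proof (intro allI impI, elim conjE)
  fix q :: "('n \<Rightarrow>\<^sub>0 nat) \<Rightarrow>\<^sub>0 'f"
  assume q: "range (Poly_Mapping.lookup q) \<subseteq> K" "mpoly_eval x q = 0"
  have inj: "inj_on Poly_Mapping.lookup (Poly_Mapping.keys q)"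
    by (simp add: inj_on_def)
  let ?c = "\<lambda>m. Poly_Mapping.lookup q (Abs_poly_mapping m)"
  have "(\<Sum>m\<in>Poly_Mapping.lookup ` Poly_Mapping.keys q. ?c m * monomial_value x m) = 0"
    using q(2) unfolding mpoly_eval_eq sum.reindex[OF inj] by simp
  then have "?c m = 0" if "m \<in> Poly_Mapping.lookup ` Poly_Mapping.keys q" for m
    using q(1) that by (intro assms[of _ ?c m]) auto
  then have "Poly_Mapping.keys q = {}"
    by (fastforce simp: in_keys_iff)
  then show "q = 0"
    by simp
qed

section \<open>Polynomials that avoid one variable\<close>

text \<open>For a ring \<open>K\<close> these are the values of polynomials in the
  \<open>x i\<close> with \<open>i \<noteq> k\<close>, built up term by term. Terms may repeat, so
  sums and products need no collecting of like terms; \<open>monomial_span_repr\<close> does this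
  once.\<close>

inductive_set monomial_span :: "'f set \<Rightarrow> ('n::finite \<Rightarrow> 'f) \<Rightarrow> 'n \<Rightarrow> 'f::field set"
  for K x k where
  zero: "0 \<in> monomial_span K x k"
| add: "c \<in> K \<Longrightarrow> m k = 0 \<Longrightarrow> s \<in> monomial_span K x k \<Longrightarrow>
    c * monomial_value x m + s \<in> monomial_span K x k"

lemma monomial_span_plus:
  "a \<in> monomial_span K x k \<Longrightarrow> b \<in> monomial_span K x k \<Longrightarrow> a + b \<in> monomial_span K x k"
  by (induction a rule: monomial_span.induct) (auto simp: add.assoc intro: monomial_span.add)

lemma monomial_span_sum:
  "(\<And>i. i \<in> I \<Longrightarrow> f i \<in> monomial_span K x k) \<Longrightarrow> sum f I \<in> monomial_span K x k"
  by (induction I rule: infinite_finite_induct) (auto intro: monomial_span.zero monomial_span_plus)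

lemma monomial_span_single:
  "c \<in> K \<Longrightarrow> m k = 0 \<Longrightarrow> c * monomial_value x m \<in> monomial_span K x k"
  using monomial_span.add[of c K m k 0 x] by (simp add: monomial_span.zero)

lemma monomial_span_times:
  assumes K: "\<And>c d. c \<in> K \<Longrightarrow> d \<in> K \<Longrightarrow> c * d \<in> K"
    and a: "a \<in> monomial_span K x k" and b: "b \<in> monomial_span K x k"
  shows "a * b \<in> monomial_span K x k"
  using a
proof induction
  case zero
  show ?case by (simp add: monomial_span.zero)
next
  case (add c m s)
  have "c * monomial_value x m * b \<in> monomial_span K x k"
    using b
  proof induction
    case zero
    show ?case by (simp add: monomial_span.zero)
  next
    case (add d l t)
    have "c * monomial_value x m * (d * monomial_value x l) = (c * d) * monomial_value x (\<lambda>i. m i + l i)"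
      by (simp add: monomial_value_add)
    moreover have "\<dots> \<in> monomial_span K x k"
      using K[of c d] add.hyps \<open>c \<in> K\<close> \<open>m k = 0\<close> by (intro monomial_span_single) auto
    ultimately have "c * monomial_value x m * (d * monomial_value x l) \<in> monomial_span K x k"
      by metis
    with add.IH show ?case
      by (simp add: ring_distribs monomial_span_plus)
  qed
  with add.IH show ?case
    by (simp add: ring_distribs monomial_span_plus)
qed

lemma monomial_span_power:
  assumes K: "\<And>c d. c \<in> K \<Longrightarrow> d \<in> K \<Longrightarrow> c * d \<in> K" and "1 \<in> K"
    and a: "a \<in> monomial_span K x k"
  shows "a ^ i \<in> monomial_span K x k"
proof (induction i)
  case 0
  show ?case
    using monomial_span_single[of 1 K "\<lambda>_. 0" k x] \<open>1 \<in> K\<close> by (simp add: monomial_value_def)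
next
  case (Suc i)
  then show ?case
    using monomial_span_times[OF K a] by simp
qed

text \<open>Like terms are collected along the induction: a new term
  \<open>c * monomial_value x m\<close> adds \<open>c\<close> to the coefficient of
  \<open>m\<close>.\<close>

lemma monomial_span_repr:
  assumes K: "\<And>c d. c \<in> K \<Longrightarrow> d \<in> K \<Longrightarrow> c + d \<in> K" "0 \<in> K"
    and "s \<in> monomial_span K x k"
  shows "\<exists>A c. finite A \<and> (\<forall>m. c m \<in> K) \<and> (\<forall>m\<in>A. m k = 0) \<and>
    s = (\<Sum>m\<in>A. c m * monomial_value x m)"
  using assms(3)
proof induction
  case zero
  then show ?case
    using K(2) by (intro exI[of _ "{}"] exI[of _ "\<lambda>_. 0"]) auto
next
  case (add c m s)
  then obtain A d where A: "finite A" "\<And>m. d m \<in> K" "\<And>m. m \<in> A \<Longrightarrow> m k = 0"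
    and s: "s = (\<Sum>m\<in>A. d m * monomial_value x m)" by blast
  \<comment> \<open>Outside \<open>A\<close> the values of \<open>d\<close> are arbitrary; with 0
    there, enlarging the index set by \<open>m\<close> leaves the sum unchanged.\<close>
  define d' where "d' = (\<lambda>l. if l \<in> A then d l else 0)"
  define e where "e = (\<lambda>l. if l = m then c + d' l else d' l)"
  have s': "s = (\<Sum>l\<in>insert m A. d' l * monomial_value x l)"
    unfolding s d'_def using A(1) by (intro sum.mono_neutral_cong_left) auto
  have "(\<Sum>l\<in>insert m A. e l * monomial_value x l) =
      (\<Sum>l\<in>insert m A. (if l = m then c else 0) * monomial_value x l) + s"
    unfolding s' sum.distrib[symmetric] e_def by (intro sum.cong) (auto simp: ring_distribs)
  also have "(\<Sum>l\<in>insert m A. (if l = m then c else 0) * monomial_value x l) = c * monomial_value x m"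
    using A(1) by (subst sum.remove[of _ m]) (auto intro!: sum.neutral)
  finally have "c * monomial_value x m + s = (\<Sum>l\<in>insert m A. e l * monomial_value x l)" ..
  moreover have "e l \<in> K" for l
    using A(2) K add.hyps by (auto simp: e_def d'_def)
  ultimately show ?case
    using A(1,3) add.hyps by (intro exI[of _ "insert m A"] exI[of _ e]) auto
qed

text \<open>Each coefficient \<open>f i\<close> is a combination of monomials free of
  \<open>x k\<close>. The terms of \<open>f i * x k ^ i\<close> then have exponent \<open>i\<close>
  at \<open>k\<close>, so terms from different \<open>i\<close> never meet, and independence
  annihilates every coefficient.\<close>

lemma alg_independent_transcendental:
  fixes x :: "'n::finite \<Rightarrow> 'f::field"
  assumes x: "alg_independent K x"
    and K: "\<And>c d. c \<in> K \<Longrightarrow> d \<in> K \<Longrightarrow> c + d \<in> K" "0 \<in> K"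
    and f: "\<And>i. i \<le> d \<Longrightarrow> f i \<in> monomial_span K x k"
    and zero: "(\<Sum>i\<le>d. f i * x k ^ i) = 0"
    and "i \<le> d"
  shows "f i = 0"
proof -
  have "\<exists>A c. finite A \<and> (\<forall>m. c m \<in> K) \<and> (\<forall>m\<in>A. m k = 0) \<and>
      f i = (\<Sum>m\<in>A. c m * monomial_value x m)" if "i \<le> d" for i
    using monomial_span_repr[OF K f] that by blast
  then obtain A c where A: "\<And>i. i \<le> d \<Longrightarrow> finite (A i)" "\<And>i m. i \<le> d \<Longrightarrow> c i m \<in> K"
      "\<And>i m. i \<le> d \<Longrightarrow> m \<in> A i \<Longrightarrow> m k = 0"
    and fA: "\<And>i. i \<le> d \<Longrightarrow> f i = (\<Sum>m\<in>A i. c i m * monomial_value x m)"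
    by metis
  define I where "I = Sigma {..d} A"
  \<comment> \<open>\<open>h\<close> moves the term \<open>m\<close> of \<open>f i\<close> to its
    place in the whole polynomial; \<open>e\<close> recovers its coefficient, reading
    \<open>i\<close> off the exponent at \<open>k\<close>.\<close>
  define h where "h = (\<lambda>(i, m). m(k := i) :: 'n \<Rightarrow> nat)"
  define e where "e = (\<lambda>m. c (m k) (m(k := 0)))"
  have upd: "m(k := 0) = m" if "m k = 0" for m :: "'n \<Rightarrow> nat"
    using that by auto
  have inj: "inj_on h I"
  proof (rule inj_onI, clarsimp simp: I_def h_def)
    fix i m i' m'
    assume *: "i \<le> d" "m \<in> A i" "i' \<le> d" "m' \<in> A i'" "m(k := i) = m'(k := i')"
    from *(5) have "i = i'" "m(k := 0) = m'(k := 0)"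
      by (metis fun_upd_same, metis fun_upd_upd)
    with * A(3) show "i = i' \<and> m = m'" by (metis upd)
  qed
  have eh: "e (h (i, m)) = c i m" if "(i, m) \<in> I" for i m
    using that A(3) by (auto simp: e_def h_def I_def upd)
  have "(\<Sum>m\<in>h ` I. e m * monomial_value x m) = (\<Sum>(i, m)\<in>I. c i m * monomial_value x m * x k ^ i)"
    unfolding sum.reindex[OF inj]
  proof (rule sum.cong[OF refl], clarsimp)
    fix i m assume im: "(i, m) \<in> I"
    then have "m k = 0" using A(3) by (auto simp: I_def)
    then have "monomial_value x (h (i, m)) = x k ^ i * monomial_value x m"
      by (subst monomial_value_split[of _ _ k]) (simp add: h_def upd)
    then show "e (h (i, m)) * monomial_value x (h (i, m)) = c i m * monomial_value x m * x k ^ i"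
      using eh[OF im] by simp
  qed
  also have "\<dots> = (\<Sum>i\<le>d. f i * x k ^ i)"
    unfolding I_def using A(1) by (subst sum.Sigma[symmetric]) (auto simp: fA sum_distrib_right)
  finally have 0: "(\<Sum>m\<in>h ` I. e m * monomial_value x m) = 0"
    using zero by simp
  have "finite (h ` I)" using A(1) by (auto simp: I_def)
  moreover have "e m \<in> K" if "m \<in> h ` I" for m
    using that eh A(2) by (auto simp: I_def)
  ultimately have "e (h (i, m)) = 0" if "m \<in> A i" for m
    using alg_independentD[OF x K(2) _ _ 0, of "h (i, m)"] that \<open>i \<le> d\<close> by (auto simp: I_def)
  then have "c i m = 0" if "m \<in> A i" for m
    using eh[of i m] that \<open>i \<le> d\<close> by (auto simp: I_def)
  then show ?thesis
    using fA[OF \<open>i \<le> d\<close>] by simp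
qed

text \<open>Sorted by the exponent of \<open>z\<close>, a relation becomes a polynomial in
  \<open>z\<close> over the span, whose coefficients vanish by transcendence of \<open>z\<close>.
  Each such coefficient is in turn a relation among the \<open>x i\<close> with
  \<open>i \<noteq> k\<close>, and independence of \<open>x\<close> makes it trivial.\<close>

lemma alg_independent_updI:
  fixes x :: "'n::finite \<Rightarrow> 'f::field"
  assumes x: "alg_independent K x" and "0 \<in> K"
    and z: "\<And>f d i. (\<And>i. f i \<in> monomial_span K x k) \<Longrightarrow> (\<Sum>i\<le>d. f i * z ^ i) = 0 \<Longrightarrow> i \<le> d \<Longrightarrow> f i = 0"
  shows "alg_independent K (x(k := z))"
proof (rule alg_independentI)
  fix A c m
  assume A: "finite A" "\<And>m. m \<in> A \<Longrightarrow> c m \<in> K"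
    and 0: "(\<Sum>m\<in>A. c m * monomial_value (x(k := z)) m) = 0" and m: "m \<in> A"
  define f where "f = (\<lambda>i. \<Sum>m | m \<in> A \<and> m k = i. c m * monomial_value x (m(k := 0)))"
  define d where "d = Max ((\<lambda>m. m k) ` A)"
  have d: "m k \<le> d" if "m \<in> A" for m
    using that A(1) by (auto simp: d_def)
  have "(\<Sum>i\<le>d. f i * z ^ i) = (\<Sum>i\<le>d. \<Sum>m | m \<in> A \<and> m k = i. c m * monomial_value (x(k := z)) m)"
  proof (rule sum.cong[OF refl])
    fix i
    have "monomial_value (x(k := z)) m = z ^ m k * monomial_value x (m(k := 0))" for m
      by (subst monomial_value_split[of _ _ k]) (auto intro: monomial_value_cong)
    then show "f i * z ^ i = (\<Sum>m | m \<in> A \<and> m k = i. c m * monomial_value (x(k := z)) m)"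
      unfolding f_def sum_distrib_right by (intro sum.cong) auto
  qed
  also have "\<dots> = 0"
    unfolding 0[symmetric] using d by (intro sum.group A(1)) auto
  finally have "(\<Sum>i\<le>d. f i * z ^ i) = 0" .
  moreover have "f i \<in> monomial_span K x k" for i
    unfolding f_def by (intro monomial_span_sum monomial_span_single A(2)) auto
  ultimately have "f (m k) = 0"
    using z d[OF m] by blast
  \<comment> \<open>Among exponents with the same value at \<open>k\<close>, resetting that value to
    0 is injective, so \<open>f (m k)\<close> is a sum over distinct monomials.\<close>
  let ?B = "{l \<in> A. l k = m k}"
  have upd: "(l(k := 0))(k := m k) = l" if "l \<in> ?B" for l
    using that by auto
  then have inj: "inj_on (\<lambda>l. l(k := 0)) ?B"
    by (rule inj_on_inverseI[where g = "\<lambda>l. l(k := m k)"])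
  have "(\<Sum>l\<in>(\<lambda>l. l(k := 0)) ` ?B. c (l(k := m k)) * monomial_value x l) = f (m k)"
    unfolding sum.reindex[OF inj] f_def by (rule sum.cong) (use upd in auto)
  then have 0: "(\<Sum>l\<in>(\<lambda>l. l(k := 0)) ` ?B. c (l(k := m k)) * monomial_value x l) = 0"
    using \<open>f (m k) = 0\<close> by simp
  have fin: "finite ((\<lambda>l. l(k := 0)) ` ?B)"
    using A(1) by simp
  have "c (l(k := m k)) \<in> K" if l: "l \<in> (\<lambda>l. l(k := 0)) ` ?B" for l
  proof -
    from l obtain l' where "l' \<in> ?B" "l = l'(k := 0)" by blast
    then show ?thesis using upd[of l'] A(2)[of l'] by simp
  qed
  from alg_independentD[OF x \<open>0 \<in> K\<close> fin this 0, of "m(k := 0)"]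
  have "c ((m(k := 0))(k := m k)) = 0"
    using m by blast
  then show "c m = 0" by simp
qed

text \<open>The shape \<open>a / x k\<close> is that of a mutated variable. Once denominators are
  cleared, the coefficients are \<open>f i * a ^ i\<close>, still free of \<open>x k\<close> because
  \<open>a\<close> is. Transcendence of \<open>x k\<close> makes them 0, and the power of
  \<open>a\<close> cancels.\<close>

lemma alg_independent_exchange:
  fixes x :: "'n::finite \<Rightarrow> 'f::field"
  assumes x: "alg_independent K x"
    and K: "\<And>c d. c \<in> K \<Longrightarrow> d \<in> K \<Longrightarrow> c + d \<in> K" "\<And>c d. c \<in> K \<Longrightarrow> d \<in> K \<Longrightarrow> c * d \<in> K"
      "0 \<in> K" "1 \<in> K"
    and a: "a \<in> monomial_span K x k" "a \<noteq> 0" and "x k \<noteq> 0"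
  shows "alg_independent K (x(k := a / x k))"
proof (rule alg_independent_updI[OF x K(3)])
  fix f d i
  assume f: "\<And>i. f i \<in> monomial_span K x k" and 0: "(\<Sum>i\<le>d. f i * (a / x k) ^ i) = 0" and i: "i \<le> d"
  \<comment> \<open>Clearing denominators reverses the polynomial.\<close>
  have "(\<Sum>i\<le>d. (f (d - i) * a ^ (d - i)) * x k ^ i) = (\<Sum>i\<le>d. f i * a ^ i * x k ^ (d - i))"
    by (rule sum.reindex_bij_witness[of _ "\<lambda>i. d - i" "\<lambda>i. d - i"]) auto
  also have "\<dots> = (\<Sum>i\<le>d. f i * (a / x k) ^ i) * x k ^ d"
    unfolding sum_distrib_right using \<open>x k \<noteq> 0\<close>
    by (intro sum.cong refl) (simp add: power_divide power_diff)
  finally have "(\<Sum>i\<le>d. (f (d - i) * a ^ (d - i)) * x k ^ i) = 0"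
    using 0 by simp
  then have "f (d - (d - i)) * a ^ (d - (d - i)) = 0"
    using i
    by (intro alg_independent_transcendental[OF x K(1,3), of d "\<lambda>i. f (d - i) * a ^ (d - i)" k "d - i"]
        monomial_span_times monomial_span_power f a K) auto
  then show "f i = 0"
    using i a(2) by simp
qed

section \<open>Mutated matrices and free generation\<close>

lemma is_subfield_hull: "is_subfield (is_subfield hull A)"
  by (rule hull_in) (auto simp: is_subfield_def)

lemma skew_symmetrizable_diag: "skew_symmetrizable B \<Longrightarrow> B $ k $ k = 0"
  unfolding skew_symmetrizable_def
  by (metis add.inverse_inverse equal_neg_zero mult_eq_0_iff order_less_irrefl)

definition mutated_entry :: "'n \<Rightarrow> int ^ 'n ^ 'n \<Rightarrow> 'n \<Rightarrow> 'n \<Rightarrow> int" where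
  "mutated_entry k B i j =
     (if i = k \<or> j = k then - B $ i $ j
      else B $ i $ j + sgn (B $ i $ k) * pos_part (B $ i $ k * B $ k $ j))"

text \<open>For a fixed sign of \<open>b\<close> the correction in matrix mutation is linear in
  \<open>b\<close>; this lets \<open>prod_mutated_cluster\<close> collect it into a power with
  exponent \<open>b\<close>. The next lemma treats the other sign.\<close>

lemma sgn_times_pos_part_nonneg:
  "0 \<le> b \<Longrightarrow> sgn a * pos_part (a * b) = pos_part a * b"
  by (auto simp: pos_part_def sgn_if max_def zero_le_mult_iff mult_le_0_iff)

lemma sgn_times_pos_part_nonpos:
  "b \<le> 0 \<Longrightarrow> sgn a * pos_part (a * b) = pos_part (- a) * b"
  by (auto simp: pos_part_def sgn_if max_def zero_le_mult_iff mult_le_0_iff)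

text \<open>The same multipliers \<open>r\<close> work after mutation: their positivity makes the
  signs of \<open>B\<close> antisymmetric, and the correction terms satisfy the skew relation by
  themselves.\<close>

lemma skew_symmetrizable_mutation:
  assumes "skew_symmetrizable B"
  shows "skew_symmetrizable (\<chi> i j. mutated_entry k B i j)"
proof -
  obtain r where r: "\<And>i. r i > 0" and skew: "\<And>i j. r i * B $ i $ j = - (r j * B $ j $ i)"
    using assms unfolding skew_symmetrizable_def by blast
  have sgn: "sgn (B $ i $ j) = - sgn (B $ j $ i)" for i j
  proof -
    have "sgn (r i * B $ i $ j) = - sgn (r j * B $ j $ i)"
      by (simp add: skew[of i j])
    then show ?thesis using r by (simp add: sgn_mult)
  qed
  have scale: "r i * pos_part b = pos_part (r i * b)" for i b
    using max_mult_distrib_left[of "r i" b 0] r[of i] by (simp add: pos_part_def)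
  \<comment> \<open>If the signs of \<open>B $ i $ k\<close> and \<open>B $ k $ j\<close> agree, the
    scaled positive parts are equal and the outer signs opposite; if they differ, both corrections
    vanish.\<close>
  have summand: "r i * (sgn (B $ i $ k) * pos_part (B $ i $ k * B $ k $ j)) =
      - (r j * (sgn (B $ j $ k) * pos_part (B $ j $ k * B $ k $ i)))" for i j
  proof (cases "sgn (B $ i $ k) = sgn (B $ k $ j)")
    case True
    have "r i * (B $ i $ k * B $ k $ j) = (r i * B $ i $ k) * B $ k $ j"
      by simp
    also have "\<dots> = - (r k * B $ k $ j) * B $ k $ i"
      unfolding skew[of i k] by simp
    also have "\<dots> = r j * (B $ j $ k * B $ k $ i)"
      unfolding skew[of k j] by simp
    finally have "r i * pos_part (B $ i $ k * B $ k $ j) = r j * pos_part (B $ j $ k * B $ k $ i)"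
      by (simp add: scale)
    then show ?thesis
      using True sgn[of j k] by (simp add: mult.left_commute)
  next
    case False
    then have "sgn (B $ j $ k) \<noteq> sgn (B $ k $ i)"
      using sgn by (metis add.inverse_inverse)
    have *: "sgn a * pos_part (a * b) = 0" if "sgn a \<noteq> sgn b" for a b :: int
      using that by (auto simp: pos_part_def sgn_if max_def zero_le_mult_iff mult_le_0_iff split: if_splits)
    show ?thesis
      unfolding *[OF False] *[OF \<open>sgn (B $ j $ k) \<noteq> sgn (B $ k $ i)\<close>] by simp
  qed
  have "r i * mutated_entry k B i j = - (r j * mutated_entry k B j i)" for i j
    using skew[of i j] summand[of i j] by (auto simp: mutated_entry_def distrib_left)
  with r show ?thesis
    unfolding skew_symmetrizable_def vec_lambda_beta by blast
qed

section \<open>Arithmetic of the coefficients and free generating tuples\<close>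

locale coefficients =
  fixes P :: "'f::field_char_0 set"
  assumes coefficient_group: "coefficient_group P"
begin

lemma P_nonzero: "p \<in> P \<Longrightarrow> p \<noteq> 0"
  and P_one: "1 \<in> P"
  and P_mult: "p \<in> P \<Longrightarrow> q \<in> P \<Longrightarrow> p * q \<in> P"
  and P_inverse: "p \<in> P \<Longrightarrow> inverse p \<in> P"
  using coefficient_group unfolding coefficient_group_def by auto

lemma P_divide: "p \<in> P \<Longrightarrow> q \<in> P \<Longrightarrow> p / q \<in> P"
  by (simp add: divide_inverse P_mult P_inverse)

lemma P_power: "p \<in> P \<Longrightarrow> p ^ i \<in> P"
  by (induction i) (auto intro: P_one P_mult)

lemma P_powi: "p \<in> P \<Longrightarrow> p powi i \<in> P"
  by (simp add: power_int_def P_power P_inverse)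

lemma P_prod: "(\<And>i. i \<in> I \<Longrightarrow> f i \<in> P) \<Longrightarrow> prod f I \<in> P"
  by (induction I rule: infinite_finite_induct) (auto intro: P_one P_mult)

text \<open>For distinct \<open>p\<close> and \<open>q\<close> the sum is the image of a nonzero
  element of the group ring, which embeds in the field; for \<open>p = q\<close> it is
  \<open>2 * p\<close>, nonzero in characteristic 0.\<close>

lemma P_sum_nonzero:
  assumes "p \<in> P" "q \<in> P"
  shows "p + q \<noteq> 0"
proof
  assume 0: "p + q = 0"
  show False
  proof (cases "p = q")
    case True
    then show False using 0 P_nonzero[OF assms(1)] by simp
  next
    case False
    define c :: "'f \<Rightarrow>\<^sub>0 rat" where "c = Poly_Mapping.single p 1 + Poly_Mapping.single q 1"
    have keys: "Poly_Mapping.keys c \<subseteq> {p, q}"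
      unfolding c_def using Poly_Mapping.keys_add by (auto dest!: subsetD[OF Poly_Mapping.keys_add] split: if_splits)
    have "group_ring_map c = p + q"
      unfolding group_ring_map_superset[OF _ keys, simplified]
      using False by (simp add: c_def lookup_add lookup_single)
    moreover have "group_ring_map 0 = (0 :: 'f)"
      by (simp add: group_ring_map_def)
    ultimately have "group_ring_map c = group_ring_map 0"
      using 0 by simp
    moreover have "inj_on group_ring_map {c. Poly_Mapping.keys c \<subseteq> P}"
      using coefficient_group unfolding coefficient_group_def by simp
    ultimately have "c = 0"
      using keys assms by (auto dest!: inj_onD)
    moreover have "Poly_Mapping.lookup c p = 1"
      using False by (simp add: c_def lookup_add lookup_single)
    ultimately show False by simp
  qed
qed

lemma group_ring_mult:
  assumes "a \<in> group_ring P" "b \<in> group_ring P"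
  shows "a * b \<in> group_ring P"
proof -
  obtain c d where c: "Poly_Mapping.keys c \<subseteq> P" "a = group_ring_map c"
    and d: "Poly_Mapping.keys d \<subseteq> P" "b = group_ring_map d"
    using assms unfolding group_ring_def by blast
  have "(of_rat (Poly_Mapping.lookup c p) * p) * (of_rat (Poly_Mapping.lookup d q) * q) \<in> group_ring P"
    if "p \<in> Poly_Mapping.keys c" "q \<in> Poly_Mapping.keys d" for p q
  proof -
    have "p * q \<in> P" using that c d P_mult by blast
    then have "of_rat (Poly_Mapping.lookup c p * Poly_Mapping.lookup d q) * (p * q) \<in> group_ring P"
      by (rule group_ring_single)
    then show ?thesis by (simp add: of_rat_mult mult_ac)
  qed
  then show ?thesis
    unfolding c d group_ring_map_def sum_product by (intro group_ring_sum)
qed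

lemma P_subset_group_ring: "P \<subseteq> group_ring P"
  using group_ring_single[of _ P 1] by auto

lemma group_ring_subset_frac: "group_ring P \<subseteq> group_ring_frac P"
  using P_one P_subset_group_ring unfolding group_ring_frac_def
  by (clarsimp) (metis div_by_1 one_neq_zero subsetD)

lemma frac_P: "p \<in> P \<Longrightarrow> p \<in> group_ring_frac P"
  using P_subset_group_ring group_ring_subset_frac by blast

lemma frac_0: "0 \<in> group_ring_frac P"
  using group_ring_0 group_ring_subset_frac by blast

lemma frac_add:
  assumes "x \<in> group_ring_frac P" "y \<in> group_ring_frac P"
  shows "x + y \<in> group_ring_frac P"
proof -
  obtain a b c d where *: "x = a / b" "y = c / d" "b \<noteq> 0" "d \<noteq> 0"
      "a \<in> group_ring P" "b \<in> group_ring P" "c \<in> group_ring P" "d \<in> group_ring P"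
    using assms unfolding group_ring_frac_def by blast
  then have "x + y = (a * d + c * b) / (b * d)" "b * d \<noteq> 0"
    by (auto simp: add_frac_eq)
  then show ?thesis
    unfolding group_ring_frac_def using * by (blast intro: group_ring_add group_ring_mult)
qed

lemma frac_mult:
  assumes "x \<in> group_ring_frac P" "y \<in> group_ring_frac P"
  shows "x * y \<in> group_ring_frac P"
proof -
  obtain a b c d where *: "x = a / b" "y = c / d" "b \<noteq> 0" "d \<noteq> 0"
      "a \<in> group_ring P" "b \<in> group_ring P" "c \<in> group_ring P" "d \<in> group_ring P"
    using assms unfolding group_ring_frac_def by blast
  then have "x * y = (a * c) / (b * d)" "b * d \<noteq> 0"
    by auto
  then show ?thesis
    unfolding group_ring_frac_def using * by (blast intro: group_ring_mult)
qed

lemma freely_generates_nonzero: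
  fixes x :: "'n::finite \<Rightarrow> 'f"
  assumes "freely_generates P x"
  shows "x i \<noteq> 0"
proof
  assume 0: "x i = 0"
  let ?m = "(\<lambda>_. 0)(i := 1) :: 'n \<Rightarrow> nat"
  have "monomial_value x ?m = 0"
    using 0 by (subst monomial_value_split[of _ _ i]) simp
  moreover have "alg_independent (group_ring_frac P) x"
    using assms unfolding freely_generates_def by simp
  ultimately have "(1::'f) = 0"
    using alg_independentD[of "group_ring_frac P" x "{?m}" "\<lambda>_. 1" ?m] frac_0 frac_P[OF P_one]
    by simp
  then show False by simp
qed

text \<open>As \<open>a\<close> avoids \<open>x k\<close>, it lies in the subfield \<open>H\<close>
  generated by the new tuple, and \<open>x k\<close> is recovered as the quotient of
  \<open>a\<close> by the new entry. Independence is
  \<open>alg_independent_exchange\<close>.\<close>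

lemma freely_generates_exchange:
  fixes x :: "'n::finite \<Rightarrow> 'f"
  assumes x: "freely_generates P x"
    and a: "a \<in> monomial_span (group_ring_frac P) x k" "a \<noteq> 0"
  shows "freely_generates P (x(k := a / x k))" (is "freely_generates P ?y")
proof -
  define H where "H = is_subfield hull (group_ring P \<union> range ?y)"
  have H: "is_subfield H" unfolding H_def by (rule is_subfield_hull)
  have sub: "group_ring P \<union> range ?y \<subseteq> H" unfolding H_def by (rule hull_subset)
  have div: "u / v \<in> H" if "u \<in> H" "v \<in> H" for u v
    using that H unfolding is_subfield_def divide_inverse by blast
  have pow: "u ^ i \<in> H" if "u \<in> H" for u and i :: nat
    by (induction i) (use that H in \<open>auto simp: is_subfield_def\<close>)
  have prod: "prod f I \<in> H" if "\<And>i. i \<in> I \<Longrightarrow> f i \<in> H" for f and I :: "'n set"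
    using that by (induction I rule: infinite_finite_induct) (use H in \<open>auto simp: is_subfield_def\<close>)
  have frac: "group_ring_frac P \<subseteq> H"
    using sub div unfolding group_ring_frac_def by blast
  have "monomial_value x m \<in> H" if "m k = 0" for m
  proof -
    have "?y i \<in> H" for i
      using sub by blast
    then have "monomial_value ?y m \<in> H"
      unfolding monomial_value_def by (intro prod pow)
    then show ?thesis
      using monomial_value_cong[of k x ?y m] that by simp
  qed
  with a(1) have "a \<in> H"
  proof induction
    case zero
    show ?case using H unfolding is_subfield_def by blast
  next
    case (add c m s)
    have "c * monomial_value x m \<in> H" "s \<in> H"
      using add frac H unfolding is_subfield_def by blast+
    then show ?case using H unfolding is_subfield_def by blast
  qed
  moreover have "a / x k \<in> H"
    using sub by force
  ultimately have "a / (a / x k) \<in> H"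
    by (rule div)
  then have "x k \<in> H"
    using a(2) by simp
  moreover have "x j \<in> H" if "j \<noteq> k" for j
    using that sub by (metis UnCI fun_upd_other rangeI subsetD)
  ultimately have "x j \<in> H" for j
    by (cases "j = k") auto
  then have "group_ring P \<union> range x \<subseteq> H"
    using sub by auto
  then have "is_subfield hull (group_ring P \<union> range x) \<subseteq> H"
    using H by (rule hull_minimal)
  then have "H = UNIV"
    using x unfolding freely_generates_def by auto
  moreover have "alg_independent (group_ring_frac P) ?y"
    using x freely_generates_nonzero[OF x] a unfolding freely_generates_def
    by (intro alg_independent_exchange[OF _ frac_add frac_mult frac_0 frac_P[OF P_one]]) auto
  ultimately show ?thesis
    unfolding freely_generates_def H_def by simp
qed

lemma freely_generates_scale:
  fixes x :: "'n::finite \<Rightarrow> 'f"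
  assumes x: "freely_generates P x" and c: "c \<in> P"
  shows "freely_generates P (x(k := c * x k))"
proof -
  have const: "b \<in> monomial_span (group_ring_frac P) y k" if "b \<in> P" for b and y :: "'n \<Rightarrow> 'f"
    using monomial_span_single[OF frac_P[OF that], of "\<lambda>_. 0" k y] by (simp add: monomial_value_def)
  \<comment> \<open>A rescaling is a composition of two exchanges, $x_k \mapsto 1/x_k \mapsto c\,x_k$.\<close>
  have "freely_generates P ((x(k := 1 / x k))(k := c / (x(k := 1 / x k)) k))"
    by (intro freely_generates_exchange x const c P_one P_nonzero one_neq_zero zero_neq_one[symmetric])
  then show ?thesis by simp
qed

end

section \<open>Mutation and hatted variables\<close>

lemma prod_power_int: "(\<Prod>i\<in>I. f i) powi e = (\<Prod>i\<in>I. (f i :: 'a::field) powi e)"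
  by (induction I rule: infinite_finite_induct) (auto simp: power_int_mult_distrib)

lemma pos_part_diff: "pos_part b - pos_part (- b) = b"
  by (simp add: pos_part_def)

lemma pos_part_0 [simp]: "pos_part 0 = 0"
  by (simp add: pos_part_def)

definition plus_monomial :: "('f::field, 'n::finite) seed \<Rightarrow> 'n \<Rightarrow> 'f" where
  "plus_monomial S k = (\<Prod>j\<in>UNIV. clus S j powi pos_part (exch S $ j $ k))"

definition minus_monomial :: "('f::field, 'n::finite) seed \<Rightarrow> 'n \<Rightarrow> 'f" where
  "minus_monomial S k = (\<Prod>j\<in>UNIV. clus S j powi pos_part (- exch S $ j $ k))"

text \<open>The two clauses for the coefficient ratio overlap only at
  \<open>exch S $ k $ j = 0\<close>, where the power is 1, so one conditional expresses
  both.\<close>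

lemma mutation_related_iff:
  "mutation_related k S S' \<longleftrightarrow>
     (\<forall>i j. exch S' $ i $ j = mutated_entry k (exch S) i j) \<and>
     coefp S' k = coefm S k \<and> coefm S' k = coefp S k \<and>
     (\<forall>j. j \<noteq> k \<longrightarrow> coefp S' j / coefm S' j = coefp S j / coefm S j *
        (if exch S $ k $ j \<ge> 0 then coefp S k else coefm S k) powi (exch S $ k $ j)) \<and>
     (\<forall>j. j \<noteq> k \<longrightarrow> clus S' j = clus S j) \<and>
     clus S k * clus S' k = coefp S k * plus_monomial S k + coefm S k * minus_monomial S k"
  unfolding mutation_related_def mutated_entry_def plus_monomial_def minus_monomial_def
  by (intro arg_cong2[where f = "(\<and>)"] refl all_cong) (auto simp: order_le_less)

text \<open>Negating row and column \<open>k\<close> preserves the product inside the positive part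
  and reverses the sign in front, so the second correction cancels the first.\<close>

lemma mutated_entry_mutated_entry:
  assumes "\<And>i j. B' $ i $ j = mutated_entry k B i j"
  shows "mutated_entry k B' i j = B $ i $ j"
  unfolding mutated_entry_def assms by (auto simp: mutated_entry_def)

section \<open>Equivalence of seeds and paths of mutations\<close>

definition seed_equiv :: "'f::field set \<Rightarrow> ('f, 'n::finite) seed \<Rightarrow> ('f, 'n) seed \<Rightarrow> bool" where
  "seed_equiv P S T \<longleftrightarrow>
     exch S = exch T \<and> hatted S = hatted T \<and> (\<forall>i. asymp_eq P (clus S i) (clus T i))"

text \<open>A recursive form of the indexed sequences in \<open>seed_sim\<close>, suited to
  induction and concatenation.\<close>

fun seed_path :: "'f::field_char_0 set \<Rightarrow> 'n list \<Rightarrow> ('f, 'n::finite) seed \<Rightarrow> ('f, 'n) seed \<Rightarrow> bool" where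
  "seed_path P [] S T \<longleftrightarrow> is_seed P S \<and> S = T"
| "seed_path P (k # ks) S T \<longleftrightarrow> is_seed P S \<and> (\<exists>U. mutation_related k S U \<and> seed_path P ks U T)"

lemma seed_path_iff:
  "seed_path P ks S T \<longleftrightarrow>
     (\<exists>F :: nat \<Rightarrow> _. F 0 = S \<and> F (length ks) = T \<and> (\<forall>i\<le>length ks. is_seed P (F i)) \<and>
        (\<forall>i<length ks. mutation_related (ks ! i) (F i) (F (Suc i))))"
proof (induction ks arbitrary: S)
  case Nil
  show ?case by auto
next
  case (Cons k ks)
  show ?case
  proof
    assume "seed_path P (k # ks) S T"
    then obtain U where U: "is_seed P S" "mutation_related k S U" "seed_path P ks U T" by auto
    then obtain F where F: "F 0 = U" "F (length ks) = T" "\<forall>i\<le>length ks. is_seed P (F i)"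
        "\<forall>i<length ks. mutation_related (ks ! i) (F i) (F (Suc i))"
      unfolding Cons.IH by blast
    define G where "G = case_nat S F"
    have "is_seed P (G i)" if "i \<le> length (k # ks)" for i
      using that U(1) F(3) by (cases i) (auto simp: G_def)
    moreover have "mutation_related ((k # ks) ! i) (G i) (G (Suc i))" if "i < length (k # ks)" for i
      using that U(2) F(1,4) by (cases i) (auto simp: G_def)
    moreover have "G 0 = S" "G (length (k # ks)) = T"
      using F(2) by (simp_all add: G_def)
    ultimately show "\<exists>F. F 0 = S \<and> F (length (k # ks)) = T \<and> (\<forall>i\<le>length (k # ks). is_seed P (F i)) \<and>
        (\<forall>i<length (k # ks). mutation_related ((k # ks) ! i) (F i) (F (Suc i)))"
      by blast
  next
    assume "\<exists>F. F 0 = S \<and> F (length (k # ks)) = T \<and> (\<forall>i\<le>length (k # ks). is_seed P (F i)) \<and>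
        (\<forall>i<length (k # ks). mutation_related ((k # ks) ! i) (F i) (F (Suc i)))"
    then obtain F where F: "F 0 = S" "F (length (k # ks)) = T" "\<forall>i\<le>length (k # ks). is_seed P (F i)"
        "\<forall>i<length (k # ks). mutation_related ((k # ks) ! i) (F i) (F (Suc i))"
      by blast
    have "seed_path P ks (F (Suc 0)) T"
      unfolding Cons.IH using F by (intro exI[of _ "\<lambda>i. F (Suc i)"]) force
    moreover have "mutation_related k (F 0) (F (Suc 0))" "is_seed P (F 0)"
      using F(3,4) by force+
    ultimately show "seed_path P (k # ks) S T"
      using F(1) by auto
  qed
qed

lemma seed_sim_iff: "seed_sim P S T \<longleftrightarrow> (\<exists>ks. contractible ks \<and> seed_path P ks S T)"
  unfolding seed_sim_def seed_path_iff by blast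

lemma seed_path_start: "seed_path P ks S T \<Longrightarrow> is_seed P S"
  by (cases ks) auto

lemma seed_path_append:
  "seed_path P ks S T \<Longrightarrow> seed_path P ls T U \<Longrightarrow> seed_path P (ks @ ls) S U"
  by (induction ks arbitrary: S) auto

lemma seed_sim_refl: "is_seed P S \<Longrightarrow> seed_sim P S S"
  unfolding seed_sim_iff by (intro exI[of _ "[]"]) (simp add: contractible_def)

lemma seed_sim_trans:
  assumes "seed_sim P S T" "seed_sim P T U"
  shows "seed_sim P S U"
proof -
  obtain ks ls where "contractible ks" "contractible ls" "seed_path P ks S T" "seed_path P ls T U"
    using assms unfolding seed_sim_iff by blast
  then have "contractible (ks @ ls)" "seed_path P (ks @ ls) S U"
    by (auto simp: contractible_def tree_walk_append intro: seed_path_append)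
  then show ?thesis unfolding seed_sim_iff by blast
qed

text \<open>Surrounding a contractible word by two letters \<open>k\<close> keeps it contractible:
  the walk crosses an edge, closes up at its far end and comes back along the same edge. So seeds
  can be compared after mutating both in direction \<open>k\<close>.\<close>

lemma seed_sim_conjugate:
  assumes "is_seed P S" "mutation_related k S S'" "seed_sim P S' T'" "mutation_related k T' T" "is_seed P T"
  shows "seed_sim P S T"
proof -
  obtain ks where ks: "contractible ks" "seed_path P ks S' T'"
    using assms(3) unfolding seed_sim_iff by blast
  have "contractible (k # ks @ [k])"
    unfolding contractible_def
  proof
    fix v :: "'b list"
    assume "v \<in> tree_vertices"
    from ex1_implies_ex[OF tree_edge_ex1[OF this]] obtain u where u: "tree_edge k v u" ..
    then have "u \<in> tree_vertices" "tree_edge k u v"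
      by (simp add: tree_edge_def, simp add: tree_edge_sym)
    moreover from this ks(1) have "tree_walk ks u u"
      by (simp add: contractible_def)
    ultimately have "tree_walk (ks @ [k]) u v"
      unfolding tree_walk_append by auto
    with u show "tree_walk (k # ks @ [k]) v v"
      by auto
  qed
  moreover have "is_seed P T'"
    using assms(3) unfolding seed_sim_def by blast
  then have "seed_path P (k # ks @ [k]) S T"
    using assms(1,2,4,5) seed_path_append[OF ks(2), of "[k]" T] by auto
  ultimately show ?thesis unfolding seed_sim_iff by blast
qed

section \<open>The action of mutation on hatted variables\<close>

context coefficients
begin

lemma is_seedD:
  assumes "is_seed P S"
  shows "clus S i \<noteq> 0" "coefp S i \<in> P" "coefm S i \<in> P" "coefp S i \<noteq> 0" "coefm S i \<noteq> 0"
    "exch S $ i $ i = 0"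
  using assms P_nonzero freely_generates_nonzero skew_symmetrizable_diag unfolding is_seed_def by blast+

lemma monomial_nonzero: "is_seed P S \<Longrightarrow> plus_monomial S k \<noteq> 0 \<and> minus_monomial S k \<noteq> 0"
  by (simp add: plus_monomial_def minus_monomial_def is_seedD)

text \<open>By \<open>pos_part b - pos_part (- b) = b\<close>, the hatted variable is the quotient
  of the two terms of the exchange binomial.\<close>

lemma hatted_eq:
  assumes "is_seed P S"
  shows "hatted S k = (coefp S k * plus_monomial S k) / (coefm S k * minus_monomial S k)"
proof -
  have "plus_monomial S k / minus_monomial S k = (\<Prod>i\<in>UNIV. clus S i powi (exch S $ i $ k))"
    unfolding plus_monomial_def minus_monomial_def prod_dividef[symmetric]
    using is_seedD[OF assms] by (simp add: pos_part_diff flip: power_int_diff)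
  then show ?thesis
    by (simp add: hatted_def flip: times_divide_times_eq)
qed

lemma mutation_exchange:
  assumes "is_seed P S" "mutation_related k S T"
  shows "clus S k * clus T k = coefm S k * minus_monomial S k * (1 + hatted S k)"
  using assms unfolding mutation_related_iff
  by (simp add: hatted_eq monomial_nonzero is_seedD field_simps)

text \<open>Column \<open>k\<close> changes sign, which swaps the two monomials, and the
  coefficients at \<open>k\<close> are swapped as well, so the exchange relation is preserved. In
  the coefficient ratios the same base reappears with the opposite exponent.\<close>

lemma mutation_sym:
  assumes S: "is_seed P S" and rel: "mutation_related k S T"
  shows "mutation_related k T S"
proof -
  note rel' = rel[unfolded mutation_related_iff]
  have B: "exch T $ i $ j = mutated_entry k (exch S) i j" for i j
    using rel' by blast
  have ent: "exch T $ i $ k = - exch S $ i $ k" "exch T $ k $ i = - exch S $ k $ i" for i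
    using B by (simp_all add: mutated_entry_def)
  \<comment> \<open>The clusters differ at \<open>k\<close>, but there both monomials have exponent
    0, the diagonal of the matrix being 0.\<close>
  have "clus T j powi pos_part b = clus S j powi pos_part b" if "j = k \<longrightarrow> b = 0" for j b
    using rel' that by (cases "j = k") auto
  then have mon: "plus_monomial T k = minus_monomial S k" "minus_monomial T k = plus_monomial S k"
    unfolding plus_monomial_def minus_monomial_def
    using is_seedD(6)[OF S] by (auto intro!: prod.cong simp: ent)
  have ratio: "coefp S j / coefm S j = coefp T j / coefm T j *
      (if exch T $ k $ j \<ge> 0 then coefp T k else coefm T k) powi (exch T $ k $ j)" if "j \<noteq> k" for j
  proof -
    let ?e = "exch S $ k $ j"
    have T: "coefp T j / coefm T j =
        coefp S j / coefm S j * (if ?e \<ge> 0 then coefp S k else coefm S k) powi ?e"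
      "coefp T k = coefm S k" "coefm T k = coefp S k"
      using rel' that by blast+
    consider "?e = 0" | "?e > 0" | "?e < 0" by linarith
    then show ?thesis
      by cases (use is_seedD[OF S] in \<open>simp_all add: T ent power_int_minus\<close>)
  qed
  have "exch S $ i $ j = mutated_entry k (exch T) i j" for i j
    using mutated_entry_mutated_entry[of "exch T" k "exch S"] B by simp
  then show ?thesis
    unfolding mutation_related_iff mon using rel' ratio by (simp add: mult.commute add.commute)
qed

text \<open>\<open>g\<close> stands for the positive parts of column \<open>k\<close> or of its
  negative, depending on the sign of \<open>exch S $ k $ j\<close>, so one computation covers both
  cases. At \<open>k\<close>, a power of the old variable gives way to the inverse power of the new
  one, whence the denominator.\<close>

lemma prod_mutated_cluster:
  fixes S :: "('f, 'n::finite) seed"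
  assumes S: "is_seed P S" and T: "is_seed P T" and rel: "mutation_related k S T"
    and "j \<noteq> k" and g: "g k = 0"
    and entry: "\<And>i. i \<noteq> k \<Longrightarrow> exch T $ i $ j = exch S $ i $ j + g i * exch S $ k $ j"
  shows "(\<Prod>i\<in>UNIV. clus T i powi (exch T $ i $ j)) =
    (\<Prod>i\<in>UNIV. clus S i powi (exch S $ i $ j)) *
    ((\<Prod>i\<in>UNIV. clus S i powi g i) / (clus S k * clus T k)) powi (exch S $ k $ j)"
proof -
  define e where "e = exch S $ k $ j"
  note rel' = rel[unfolded mutation_related_iff]
  have Tk: "exch T $ k $ j = - e"
    using rel' by (simp add: mutated_entry_def e_def)
  have "(\<Prod>i\<in>UNIV - {k}. clus T i powi (exch T $ i $ j)) =
      (\<Prod>i\<in>UNIV - {k}. clus S i powi (exch S $ i $ j) * (clus S i powi g i) powi e)"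
    using rel' entry is_seedD(1)[OF S]
    by (intro prod.cong refl) (auto simp: power_int_add e_def simp flip: power_int_mult)
  also have "\<dots> = (\<Prod>i\<in>UNIV - {k}. clus S i powi (exch S $ i $ j)) *
      (\<Prod>i\<in>UNIV - {k}. clus S i powi g i) powi e"
    by (simp add: prod.distrib prod_power_int)
  finally have "(\<Prod>i\<in>UNIV. clus T i powi (exch T $ i $ j)) =
      clus T k powi (- e) * ((\<Prod>i\<in>UNIV - {k}. clus S i powi (exch S $ i $ j)) *
      (\<Prod>i\<in>UNIV - {k}. clus S i powi g i) powi e)"
    by (subst prod.remove[of _ k]) (simp_all add: Tk)
  moreover have "(\<Prod>i\<in>UNIV. clus S i powi g i) = (\<Prod>i\<in>UNIV - {k}. clus S i powi g i)"
    by (subst prod.remove[of _ k]) (simp_all add: g)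
  moreover have "(\<Prod>i\<in>UNIV. clus S i powi (exch S $ i $ j)) =
      clus S k powi e * (\<Prod>i\<in>UNIV - {k}. clus S i powi (exch S $ i $ j))"
    by (subst prod.remove[of _ k]) (simp_all add: e_def)
  ultimately show ?thesis
    using is_seedD(1)[OF S] is_seedD(1)[OF T]
    by (simp add: power_int_divide_distrib power_int_mult_distrib power_int_minus field_simps flip: e_def)
qed

text \<open>For \<open>j \<noteq> k\<close> and \<open>b = exch S $ k $ j\<close> this is the
  classical rule \<open>y' j = y j * y k powi pos_part b * (1 + y k) powi (- b)\<close>. It holds
  because one term of the exchange binomial, divided by the whole, is \<open>y k / (1 + y k)\<close>
  or \<open>1 / (1 + y k)\<close>. No trace of the choices made in \<open>T\<close> remains.\<close>

lemma hatted_mutation: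
  assumes S: "is_seed P S" and T: "is_seed P T" and rel: "mutation_related k S T"
  shows "hatted T j =
    (if j = k then inverse (hatted S k)
     else hatted S j * ((if exch S $ k $ j \<ge> 0 then hatted S k else 1) / (1 + hatted S k)) powi (exch S $ k $ j))"
proof (cases "j = k")
  case True
  note rel' = rel[unfolded mutation_related_iff]
  have "(\<Prod>i\<in>UNIV. clus T i powi (exch T $ i $ k)) = (\<Prod>i\<in>UNIV. inverse (clus S i powi (exch S $ i $ k)))"
  proof (rule prod.cong[OF refl])
    fix i
    show "clus T i powi (exch T $ i $ k) = inverse (clus S i powi (exch S $ i $ k))"
      using rel' is_seedD(6)[OF S] by (cases "i = k") (auto simp: mutated_entry_def power_int_minus)
  qed
  then show ?thesis
    using rel' True by (simp add: hatted_def prod_inversef[unfolded o_def] divide_inverse mult_ac)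
next
  case False
  note rel' = rel[unfolded mutation_related_iff]
  let ?b = "\<lambda>i. exch S $ i $ k"
  let ?e = "exch S $ k $ j"
  have entry: "exch T $ i $ j = exch S $ i $ j + sgn (?b i) * pos_part (?b i * ?e)" if "i \<noteq> k" for i
    using rel' that False by (simp add: mutated_entry_def)
  have ratio: "coefp T j / coefm T j = coefp S j / coefm S j * (if ?e \<ge> 0 then coefp S k else coefm S k) powi ?e"
    using rel' False by blast
  have nz: "clus S k * clus T k \<noteq> 0"
    using is_seedD(1)[OF S] is_seedD(1)[OF T] by simp
  then have y: "1 + hatted S k \<noteq> 0"
    unfolding mutation_exchange[OF S rel] by simp
  show ?thesis
  proof (cases "?e \<ge> 0")
    case True
    have "(\<Prod>i\<in>UNIV. clus T i powi (exch T $ i $ j)) = (\<Prod>i\<in>UNIV. clus S i powi (exch S $ i $ j)) *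
        (plus_monomial S k / (clus S k * clus T k)) powi ?e"
      unfolding plus_monomial_def
      by (rule prod_mutated_cluster[OF S T rel False])
        (use True is_seedD(6)[OF S] in \<open>simp_all add: entry sgn_times_pos_part_nonneg\<close>)
    then have "hatted T j = hatted S j * (coefp S k * plus_monomial S k / (clus S k * clus T k)) powi ?e"
      unfolding hatted_def ratio using True by (simp add: power_int_mult_distrib power_int_divide_distrib)
    moreover have "coefp S k * plus_monomial S k / (clus S k * clus T k) = hatted S k / (1 + hatted S k)"
      unfolding mutation_exchange[OF S rel] using hatted_eq[OF S, of k] monomial_nonzero[OF S, of k] is_seedD[OF S] y
      by (simp add: divide_simps)
    ultimately show ?thesis using True False by simp
  next
    case e: False
    have "(\<Prod>i\<in>UNIV. clus T i powi (exch T $ i $ j)) = (\<Prod>i\<in>UNIV. clus S i powi (exch S $ i $ j)) *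
        (minus_monomial S k / (clus S k * clus T k)) powi ?e"
      unfolding minus_monomial_def
      by (rule prod_mutated_cluster[OF S T rel False])
        (use e is_seedD(6)[OF S] in \<open>simp_all add: entry sgn_times_pos_part_nonpos\<close>)
    then have "hatted T j = hatted S j * (coefm S k * minus_monomial S k / (clus S k * clus T k)) powi ?e"
      unfolding hatted_def ratio using e by (simp add: power_int_mult_distrib power_int_divide_distrib)
    moreover have "coefm S k * minus_monomial S k / (clus S k * clus T k) = 1 / (1 + hatted S k)"
      unfolding mutation_exchange[OF S rel] using monomial_nonzero[OF S, of k] is_seedD[OF S] y
      by (simp add: divide_simps)
    ultimately show ?thesis using e False by simp
  qed
qed

section \<open>Invariance of the equivalence class under closed walks\<close>

lemma asymp_eq_sym: "asymp_eq P x y \<Longrightarrow> asymp_eq P y x"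
  unfolding asymp_eq_def using P_inverse by (metis inverse_divide)

lemma asymp_eq_trans:
  assumes "asymp_eq P x y" "asymp_eq P y z"
  shows "asymp_eq P x z"
proof -
  have "x / z = (x / y) * (y / z)"
    using assms by (simp add: asymp_eq_def)
  then show ?thesis
    using assms P_mult[of "x / y" "y / z"] unfolding asymp_eq_def by auto
qed

lemma seed_equiv_refl: "is_seed P S \<Longrightarrow> seed_equiv P S S"
  by (simp add: seed_equiv_def asymp_eq_def is_seedD P_one)

lemma seed_equiv_sym: "seed_equiv P S T \<Longrightarrow> seed_equiv P T S"
  unfolding seed_equiv_def using asymp_eq_sym by metis

lemma seed_equiv_trans: "seed_equiv P S T \<Longrightarrow> seed_equiv P T U \<Longrightarrow> seed_equiv P S U"
  unfolding seed_equiv_def using asymp_eq_trans by metis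

text \<open>The new matrices and hatted variables are functions of the old ones. For the variable at
  \<open>k\<close>, divide the two exchange relations: \<open>1 + hatted T k\<close> cancels, and
  only quotients of coefficients and of old variables remain, all in \<open>P\<close>.\<close>

lemma seed_equiv_mutation:
  assumes S: "is_seed P S" "is_seed P S'" "mutation_related k S S'"
    and T: "is_seed P T" "is_seed P T'" "mutation_related k T T'"
    and eq: "seed_equiv P S T"
  shows "seed_equiv P S' T'"
  unfolding seed_equiv_def
proof (intro conjI allI)
  have B: "exch S = exch T" and y: "hatted S = hatted T"
    and x: "\<And>i. asymp_eq P (clus S i) (clus T i)"
    using eq unfolding seed_equiv_def by auto
  show "exch S' = exch T'"
    using S(3) T(3) by (simp add: vec_eq_iff mutation_related_iff B)
  show "hatted S' = hatted T'"
    unfolding fun_eq_iff hatted_mutation[OF S] hatted_mutation[OF T] by (simp add: B y)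
  fix i
  show "asymp_eq P (clus S' i) (clus T' i)"
  proof (cases "i = k")
    case False
    then show ?thesis
      using x S(3) T(3) by (simp add: mutation_related_iff)
  next
    case True
    have y0: "1 + hatted T k \<noteq> 0"
      using mutation_exchange[OF T(1,3)] is_seedD(1)[OF T(1)] is_seedD(1)[OF T(2)]
      by (metis mult_eq_0_iff)
    have "clus S' k = coefm S k * minus_monomial S k * (1 + hatted T k) / clus S k"
      using mutation_exchange[OF S(1,3)] is_seedD(1)[OF S(1)] y by (simp add: field_simps)
    moreover have "clus T' k = coefm T k * minus_monomial T k * (1 + hatted T k) / clus T k"
      using mutation_exchange[OF T(1,3)] is_seedD(1)[OF T(1)] by (simp add: field_simps)
    ultimately have "clus S' k / clus T' k =
        (coefm S k / coefm T k) * (minus_monomial S k / minus_monomial T k) / (clus S k / clus T k)"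
      using y0 by (simp add: mult_ac)
    also have "minus_monomial S k / minus_monomial T k =
        (\<Prod>j\<in>UNIV. (clus S j / clus T j) powi pos_part (- exch S $ j $ k))"
      unfolding minus_monomial_def B prod_dividef[symmetric] by (simp add: power_int_divide_distrib)
    finally have "clus S' k / clus T' k = (coefm S k / coefm T k) *
        (\<Prod>j\<in>UNIV. (clus S j / clus T j) powi pos_part (- exch S $ j $ k)) / (clus S k / clus T k)" .
    moreover have ratio: "clus S j / clus T j \<in> P" for j
      using x by (simp add: asymp_eq_def)
    moreover have "coefm S k / coefm T k \<in> P"
      using S(1) T(1) by (intro P_divide is_seedD(3))
    moreover have "(\<Prod>j\<in>UNIV. (clus S j / clus T j) powi pos_part (- exch S $ j $ k)) \<in> P"
      by (intro P_prod P_powi ratio)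
    ultimately have "clus S' k / clus T' k \<in> P"
      using P_divide[OF P_mult] by presburger
    then show ?thesis
      using True is_seedD(1)[OF S(2)] is_seedD(1)[OF T(2)] by (simp add: asymp_eq_def)
  qed
qed

text \<open>
  \<open>v\<close> is read as a tree vertex, the last mutation first: \<open>T\<close> arises from \<open>S\<close> by mutating along
  the path from the root to \<open>v\<close>, up to equivalence.
\<close>

fun reaches :: "('f, 'n::finite) seed \<Rightarrow> 'n list \<Rightarrow> ('f, 'n) seed \<Rightarrow> bool" where
  "reaches S [] T \<longleftrightarrow> seed_equiv P S T"
| "reaches S (k # v) T \<longleftrightarrow> (\<exists>U U'. is_seed P U \<and> is_seed P U' \<and> reaches S v U \<and>
     mutation_related k U U' \<and> seed_equiv P U' T)"

lemma reaches_equiv: "reaches S v T \<Longrightarrow> seed_equiv P T T' \<Longrightarrow> reaches S v T'"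
  by (cases v) (auto intro: seed_equiv_trans)

text \<open>An edge away from the root records one more mutation. An edge towards the root undoes
  the last one: by symmetry and compatibility with mutation, \<open>T'\<close> is equivalent to the
  seed \<open>U\<close> at which that mutation started.\<close>

lemma reaches_step:
  assumes "reaches S v T" "tree_edge k v w" "mutation_related k T T'" "is_seed P T" "is_seed P T'"
  shows "reaches S w T'"
proof -
  consider "w = k # v" | "v = k # w"
    using assms(2) unfolding tree_edge_def by blast
  then show ?thesis
  proof cases
    case 1
    then show ?thesis
      using assms seed_equiv_refl by auto
  next
    case 2
    then obtain U U' where U: "is_seed P U" "is_seed P U'" "reaches S w U"
        "mutation_related k U U'" "seed_equiv P U' T"
      using assms(1) by auto
    have "seed_equiv P U T'"
      by (rule seed_equiv_mutation[OF U(2,1) mutation_sym[OF U(1,4)] assms(4,5,3) U(5)])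
    then show ?thesis using U(3) reaches_equiv by blast
  qed
qed

lemma reaches_path:
  "seed_path P ks T T' \<Longrightarrow> tree_walk ks v w \<Longrightarrow> reaches S v T \<Longrightarrow> reaches S w T'"
proof (induction ks arbitrary: v T)
  case (Cons k ks)
  then obtain U u where "is_seed P T" "mutation_related k T U" "seed_path P ks U T'"
      "tree_edge k v u" "tree_walk ks u w"
    by auto
  moreover from this have "is_seed P U" by (blast dest: seed_path_start)
  ultimately show ?case
    using Cons reaches_step by blast
qed auto

text \<open>A contractible word leads from the root \<open>[]\<close> back to it, and at the root
  \<open>reaches\<close> is plain equivalence with the starting seed.\<close>

lemma seed_sim_imp_equiv:
  assumes "seed_sim P S T"
  shows "seed_equiv P S T"
proof -
  obtain ks where ks: "contractible ks" "seed_path P ks S T"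
    using assms unfolding seed_sim_iff by blast
  then have "tree_walk ks [] []"
    by (simp add: contractible_def tree_vertices_def)
  moreover have "reaches S [] S"
    using seed_path_start[OF ks(2)] by (simp add: seed_equiv_refl)
  ultimately show ?thesis
    using reaches_path[OF ks(2)] by fastforce
qed

section \<open>Rescaling seeds by contractible sequences\<close>

lemma monomial_eq_monomial_value:
  "plus_monomial S k = monomial_value (clus S) (\<lambda>j. nat (pos_part (exch S $ j $ k)))"
  "minus_monomial S k = monomial_value (clus S) (\<lambda>j. nat (pos_part (- exch S $ j $ k)))"
  by (simp_all add: plus_monomial_def minus_monomial_def monomial_value_def pos_part_def power_int_nonneg_exp)

text \<open>Distinct monomials are independent, so a vanishing sum would force a coefficient in
  \<open>P\<close> to be 0. If the two exponent vectors coincide, the coefficients add up and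
  \<open>P_sum_nonzero\<close> applies.\<close>

lemma exchange_binomial_nonzero:
  assumes S: "is_seed P S"
  shows "coefp S k * plus_monomial S k + coefm S k * minus_monomial S k \<noteq> 0"
proof
  assume 0: "coefp S k * plus_monomial S k + coefm S k * minus_monomial S k = 0"
  let ?p = "\<lambda>j. nat (pos_part (exch S $ j $ k))" and ?m = "\<lambda>j. nat (pos_part (- exch S $ j $ k))"
  show False
  proof (cases "?p = ?m")
    case True
    then have "(coefp S k + coefm S k) * minus_monomial S k = 0"
      using 0 unfolding monomial_eq_monomial_value by (simp add: distrib_right)
    then show False
      using P_sum_nonzero is_seedD(2,3)[OF S] monomial_nonzero[OF S] by simp
  next
    case False
    let ?c = "\<lambda>m. if m = ?p then coefp S k else coefm S k"
    have indep: "alg_independent (group_ring_frac P) (clus S)"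
      using S unfolding is_seed_def freely_generates_def by blast
    have sum: "(\<Sum>m\<in>{?p, ?m}. ?c m * monomial_value (clus S) m) = 0"
      using 0 False unfolding monomial_eq_monomial_value by simp
    have "?c m \<in> group_ring_frac P" for m
      using is_seedD(2,3)[OF S] frac_P by presburger
    from alg_independentD[OF indep frac_0 _ this sum, of ?p] have "coefp S k = 0"
      by simp
    then show False
      using is_seedD(4)[OF S] by simp
  qed
qed

lemma mutation_exists:
  fixes S :: "('f, 'n::finite) seed"
  assumes S: "is_seed P S"
  shows "\<exists>T. is_seed P T \<and> mutation_related k S T"
proof -
  define a where "a = coefp S k * plus_monomial S k + coefm S k * minus_monomial S k"
  \<comment> \<open>Away from \<open>k\<close> only the ratio of the coefficients is prescribed;
    here the plus coefficient takes the whole factor.\<close>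
  define T :: "('f, 'n) seed" where "T = \<lparr>exch = (\<chi> i j. mutated_entry k (exch S) i j),
    coefp = (\<lambda>j. if j = k then coefm S k else
      coefp S j * (if exch S $ k $ j \<ge> 0 then coefp S k else coefm S k) powi (exch S $ k $ j)),
    coefm = (\<lambda>j. if j = k then coefp S k else coefm S j),
    clus = (clus S)(k := a / clus S k)\<rparr>"
  have "a \<noteq> 0"
    unfolding a_def by (rule exchange_binomial_nonzero[OF S])
  \<comment> \<open>The zero diagonal keeps \<open>clus S k\<close> out of the binomial, as
    \<open>freely_generates_exchange\<close> requires.\<close>
  moreover have "a \<in> monomial_span (group_ring_frac P) (clus S) k"
    unfolding a_def monomial_eq_monomial_value
    using is_seedD[OF S] by (intro monomial_span_plus monomial_span_single frac_P) simp_all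
  moreover have "freely_generates P (clus S)" "skew_symmetrizable (exch S)"
    using S unfolding is_seed_def by blast+
  ultimately have "is_seed P T"
    using is_seedD(2,3)[OF S]
    by (simp add: is_seed_def T_def freely_generates_exchange skew_symmetrizable_mutation P_mult P_powi)
  moreover have "mutation_related k S T"
    using is_seedD(1)[OF S] by (simp add: mutation_related_iff T_def a_def)
  ultimately show ?thesis by blast
qed

text \<open>Away from \<open>k\<close>, mutation sees only the ratios of the coefficients, so
  \<open>S\<close> and \<open>T\<close> have a common mutation \<open>U\<close>, and the word
  \<open>k, k\<close> connects them.\<close>

lemma seed_sim_rescale_coefficients_fixing:
  assumes S: "is_seed P S" and T: "is_seed P T"
    and eq: "exch S = exch T" "clus S = clus T" "\<And>j. coefp S j / coefm S j = coefp T j / coefm T j"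
    and k: "coefp S k = coefp T k" "coefm S k = coefm T k"
  shows "seed_sim P S T"
proof -
  obtain U where U: "is_seed P U" "mutation_related k S U"
    using mutation_exists[OF S] by blast
  have "plus_monomial S k = plus_monomial T k" "minus_monomial S k = minus_monomial T k"
    by (simp_all add: plus_monomial_def minus_monomial_def eq)
  then have "mutation_related k T U"
    using U(2) unfolding mutation_related_iff by (simp add: eq k)
  then show ?thesis
    by (intro seed_sim_conjugate[OF S U(2) seed_sim_refl[OF U(1)] mutation_sym[OF T] T])
qed

lemma seed_sim_rescale_coefficients:
  fixes S :: "('f, 'n::finite) seed"
  assumes card: "CARD('n) \<ge> 2" and S: "is_seed P S" and T: "is_seed P T"
    and eq: "exch S = exch T" "clus S = clus T" "\<And>j. coefp S j / coefm S j = coefp T j / coefm T j"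
  shows "seed_sim P S T"
proof -
  have "\<not> CARD('n) \<le> Suc 0"
    using card by simp
  then obtain k l :: 'n where "k \<noteq> l"
    unfolding card_le_Suc0_iff_eq[OF finite] by blast
  \<comment> \<open>\<open>U\<close> has the coefficients of \<open>S\<close> at \<open>k\<close>
    and those of \<open>T\<close> elsewhere, so direction \<open>k\<close> serves to pass from
    \<open>S\<close> to \<open>U\<close> and direction \<open>l\<close> from \<open>U\<close> to
    \<open>T\<close>.\<close>
  define U where "U = T\<lparr>coefp := (coefp T)(k := coefp S k), coefm := (coefm T)(k := coefm S k)\<rparr>"
  have U: "is_seed P U"
    using T is_seedD[OF S] by (simp add: U_def is_seed_def)
  have "seed_sim P S U"
    by (rule seed_sim_rescale_coefficients_fixing[OF S U, of k]) (simp_all add: U_def eq)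
  moreover have "seed_sim P U T"
    by (rule seed_sim_rescale_coefficients_fixing[OF U T, of l])
      (use \<open>k \<noteq> l\<close> in \<open>simp_all add: U_def eq\<close>)
  ultimately show ?thesis by (rule seed_sim_trans)
qed

text \<open>The cluster monomials agree and cancel, since a variable may differ only where its
  exponent is 0.\<close>

lemma coefficient_ratio_eq:
  assumes S: "is_seed P S" and "hatted S j = hatted T j"
    and "\<And>i. exch S $ i $ j = exch T $ i $ j" "\<And>i. exch S $ i $ j = 0 \<or> clus S i = clus T i"
  shows "coefp S j / coefm S j = coefp T j / coefm T j"
proof -
  have prod_eq: "(\<Prod>i\<in>UNIV. clus T i powi (exch T $ i $ j)) = (\<Prod>i\<in>UNIV. clus S i powi (exch S $ i $ j))"
  proof (rule prod.cong[OF refl])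
    fix i
    show "clus T i powi (exch T $ i $ j) = clus S i powi (exch S $ i $ j)"
      using assms(3)[of i] assms(4)[of i] by auto
  qed
  have "(\<Prod>i\<in>UNIV. clus S i powi (exch S $ i $ j)) \<noteq> 0"
    using is_seedD(1)[OF S] by simp
  from iffD1[OF mult_right_cancel[OF this] assms(2)[unfolded hatted_def prod_eq]]
  show ?thesis .
qed

text \<open>Dividing the coefficients at \<open>k\<close> by the same factor \<open>e\<close> as the
  variable at \<open>k\<close> leaves the mutated variable unchanged. Hence the mutations of
  \<open>S\<close> and of the adjusted seed \<open>U\<close> differ in coefficients only and are
  connected; conjugating by \<open>k\<close> connects \<open>S\<close> to \<open>U\<close>. Finally
  \<open>U\<close> and \<open>T\<close> differ in coefficients only.\<close>

lemma seed_sim_of_seed_equiv_step: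
  fixes S :: "('f, 'n::finite) seed"
  assumes card: "CARD('n) \<ge> 2" and S: "is_seed P S" and T: "is_seed P T"
    and equiv: "seed_equiv P S T" and clus: "\<And>j. j \<noteq> k \<Longrightarrow> clus S j = clus T j"
  shows "seed_sim P S T"
proof -
  define e where "e = clus S k / clus T k"
  have B: "exch S = exch T" and y: "hatted S = hatted T" and e: "e \<in> P"
    using equiv by (simp_all add: seed_equiv_def asymp_eq_def e_def)
  define U where "U = T\<lparr>coefp := (coefp T)(k := coefp S k / e), coefm := (coefm T)(k := coefm S k / e)\<rparr>"
  have U: "is_seed P U"
    using T is_seedD[OF S] e by (simp add: U_def is_seed_def P_divide)
  have U_simps: "exch U = exch T" "clus U = clus T" "coefm U k = coefm S k / e"
    by (simp_all add: U_def)
  \<comment> \<open>The one variable that differs has exponent 0 in the hatted variable at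
    \<open>k\<close>.\<close>
  have ratio_k: "coefp S k / coefm S k = coefp T k / coefm T k"
  proof (rule coefficient_ratio_eq[OF S])
    show "exch S $ i $ k = 0 \<or> clus S i = clus T i" for i
      using is_seedD(6)[OF S] clus by (cases "i = k") auto
  qed (simp_all add: B y)
  then have ratio: "coefp U j / coefm U j = coefp T j / coefm T j" for j
    using P_nonzero[OF e] by (simp add: U_def)
  have UT: "seed_sim P U T"
    by (rule seed_sim_rescale_coefficients[OF card U T _ _ ratio]) (simp_all add: U_simps)
  have yU: "hatted U = hatted S"
    unfolding y by (rule ext) (simp only: hatted_def ratio U_simps)
  obtain S' where S': "is_seed P S'" "mutation_related k S S'"
    using mutation_exists[OF S] by blast
  obtain U' where U': "is_seed P U'" "mutation_related k U U'"
    using mutation_exists[OF U] by blast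
  have B': "exch S' = exch U'"
    using S'(2) U'(2) by (simp add: vec_eq_iff mutation_related_iff B U_simps)
  have y': "hatted S' = hatted U'"
    unfolding fun_eq_iff hatted_mutation[OF S S'] hatted_mutation[OF U U'] by (simp add: yU B U_simps)
  have "minus_monomial U k = minus_monomial S k"
    unfolding minus_monomial_def
  proof (rule prod.cong[OF refl])
    fix j
    show "clus U j powi pos_part (- exch U $ j $ k) = clus S j powi pos_part (- exch S $ j $ k)"
      using clus is_seedD(6)[OF S, of k] by (cases "j = k") (simp_all add: U_simps B)
  qed
  then have "clus T k * clus U' k = coefm S k / e * minus_monomial S k * (1 + hatted S k)"
    using mutation_exchange[OF U U'(2)] by (simp add: yU U_simps)
  moreover have "clus T k = clus S k / e"
    using is_seedD(1)[OF S] is_seedD(1)[OF T] by (simp add: e_def)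
  ultimately have "clus S k * clus U' k = coefm S k * minus_monomial S k * (1 + hatted S k)"
    using P_nonzero[OF e] by (simp add: field_simps)
  then have "clus S k * clus U' k = clus S k * clus S' k"
    using mutation_exchange[OF S S'(2)] by simp
  then have "clus S' k = clus U' k"
    using is_seedD(1)[OF S] by simp
  moreover have "clus S' j = clus U' j" if "j \<noteq> k" for j
    using S'(2) U'(2) that clus by (simp add: mutation_related_iff U_simps)
  ultimately have x': "clus S' = clus U'"
    by (metis ext)
  have "seed_sim P S' U'"
    by (rule seed_sim_rescale_coefficients[OF card S'(1) U'(1) B' x'])
      (rule coefficient_ratio_eq[OF S'(1)], simp_all add: y' B' x')
  then have "seed_sim P S U"
    by (rule seed_sim_conjugate[OF S S'(2) _ mutation_sym[OF U U'(2)] U])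
  then show ?thesis
    using UT by (rule seed_sim_trans)
qed

text \<open>Induction on a set \<open>A\<close> containing the indices where the clusters differ.
  For empty \<open>A\<close> only coefficients are adjusted; otherwise an intermediate seed
  \<open>U\<close> matches \<open>S\<close> outside a smaller set and matches the cluster of
  \<open>T\<close> except at \<open>k\<close>.\<close>

lemma seed_equiv_imp_sim:
  fixes S :: "('f, 'n::finite) seed"
  assumes card: "CARD('n) \<ge> 2" and S: "is_seed P S" and T: "is_seed P T" and equiv: "seed_equiv P S T"
  shows "seed_sim P S T"
proof -
  have "seed_sim P S T"
    if "finite A" "is_seed P T" "seed_equiv P S T" "\<And>j. j \<notin> A \<Longrightarrow> clus S j = clus T j" for A T
    using that
  proof (induction A arbitrary: T rule: finite_induct)
    case empty
    then have "exch S = exch T" "clus S = clus T" "hatted S = hatted T"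
      by (auto simp: seed_equiv_def)
    then show ?case
      by (intro seed_sim_rescale_coefficients[OF card S empty(1)] coefficient_ratio_eq[OF S]) simp_all
  next
    case (insert k A)
    note T = \<open>is_seed P T\<close>
    have B: "exch S = exch T" and y: "hatted S = hatted T"
      and x: "\<And>i. clus S i / clus T i \<in> P" "\<And>i. asymp_eq P (clus S i) (clus T i)"
      using insert.prems(2) by (simp_all add: seed_equiv_def asymp_eq_def)
    define z where "z = (clus T)(k := clus S k)"
    have z: "clus S i / z i \<in> P" "z i \<noteq> 0" for i
      using x(1) is_seedD(1)[OF S] is_seedD(1)[OF T] P_one by (simp_all add: z_def)
    \<comment> \<open>The minus coefficients of \<open>S\<close> are kept, and the plus coefficients
      absorb the change of cluster, which preserves the hatted variables.\<close>
    define U where "U = \<lparr>exch = exch S,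
      coefp = (\<lambda>j. coefp S j * (\<Prod>i\<in>UNIV. (clus S i / z i) powi (exch S $ i $ j))),
      coefm = coefm S, clus = z\<rparr>"
    \<comment> \<open>\<open>z\<close> is the cluster of \<open>T\<close> with one entry rescaled by
      an element of \<open>P\<close>.\<close>
    have "freely_generates P ((clus T)(k := (clus S k / clus T k) * clus T k))"
      using T x(1) by (intro freely_generates_scale) (simp_all add: is_seed_def)
    then have "freely_generates P z"
      using is_seedD(1)[OF T] by (simp add: z_def)
    then have U: "is_seed P U"
      using S z(1) by (simp add: is_seed_def U_def P_mult P_prod P_powi)
    have "hatted U j = hatted S j" for j
      using z(2) by (simp add: hatted_def U_def power_int_divide_distrib prod_dividef)
    then have yU: "hatted U = hatted S" ..
    have SU: "seed_equiv P S U"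
      using z is_seedD(1)[OF S] by (simp add: seed_equiv_def yU) (simp add: asymp_eq_def U_def)
    have "seed_sim P S U"
      by (rule insert.IH[OF U SU]) (use insert.prems(3) in \<open>auto simp: U_def z_def\<close>)
    moreover have "seed_sim P U T"
      by (rule seed_sim_of_seed_equiv_step[OF card U T, of k])
        (use seed_equiv_trans[OF seed_equiv_sym[OF SU] insert.prems(2)] in \<open>auto simp: U_def z_def\<close>)
    ultimately show ?case by (rule seed_sim_trans)
  qed
  from this[of UNIV T] show ?thesis
    using T equiv by simp
qed

section \<open>Equivalence as an explicit rescaling\<close>

lemma prod_powi_pos_part:
  assumes "\<And>i. c i \<in> P"
  shows "(\<Prod>i\<in>I. c i powi pos_part (b i)) = (\<Prod>i\<in>I. c i powi b i) * (\<Prod>i\<in>I. c i powi pos_part (- b i))"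
  unfolding prod.distrib[symmetric]
  using assms P_nonzero by (intro prod.cong refl) (simp add: pos_part_def max_def flip: power_int_add)

text \<open>\<open>c\<close> is the quotient of the clusters, and \<open>d\<close> is solved from
  the formula for the plus coefficients; the formula for the minus coefficients then follows from
  equality of the hatted variables. Conversely, \<open>d\<close> cancels from the coefficient ratio,
  and the powers of \<open>c\<close> in that ratio cancel those in the cluster monomial.\<close>

lemma seed_equiv_iff_rescaling:
  fixes S T :: "('f, 'n::finite) seed"
  assumes S: "is_seed P S" and T: "is_seed P T"
  shows "seed_equiv P S T \<longleftrightarrow> exch S = exch T \<and>
    (\<exists>c d. (\<forall>j. c j \<in> P \<and> d j \<in> P) \<and>
      (\<forall>j. clus T j = clus S j / c j \<and>
        coefp T j = coefp S j / d j * (\<Prod>i\<in>UNIV. c i powi pos_part (exch S $ i $ j)) \<and>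
        coefm T j = coefm S j / d j * (\<Prod>i\<in>UNIV. c i powi pos_part (- exch S $ i $ j))))"
    (is "?L \<longleftrightarrow> exch S = exch T \<and> ?R")
proof -
  have hatted_T: "hatted T j = coefp T j / coefm T j *
      ((\<Prod>i\<in>UNIV. clus S i powi (exch S $ i $ j)) / (\<Prod>i\<in>UNIV. c i powi (exch S $ i $ j)))"
    if "exch S = exch T" "\<And>j. clus T j = clus S j / c j" for c j
    using that by (simp add: hatted_def power_int_divide_distrib prod_dividef)
  have prod_nz: "(\<Prod>i\<in>UNIV. c i powi b i) \<noteq> 0" if "\<And>i. c i \<in> P" for c and b :: "'n \<Rightarrow> int"
    using P_nonzero[OF P_prod[OF P_powi[OF that]]] .
  show ?thesis
  proof (intro iffI conjI)
    assume L: ?L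
    then show B: "exch S = exch T" by (simp add: seed_equiv_def)
    define c where "c = (\<lambda>i. clus S i / clus T i)"
    define d where "d = (\<lambda>j. coefp S j * (\<Prod>i\<in>UNIV. c i powi pos_part (exch S $ i $ j)) / coefp T j)"
    have c: "c j \<in> P" for j
      using L by (simp add: seed_equiv_def asymp_eq_def c_def)
    have d: "d j \<in> P" for j
      unfolding d_def by (intro P_divide P_mult P_prod P_powi c is_seedD[OF S] is_seedD[OF T])
    have x: "clus T j = clus S j / c j" for j
      using is_seedD(1)[OF S] is_seedD(1)[OF T] by (simp add: c_def)
    have plus: "coefp T j = coefp S j / d j * (\<Prod>i\<in>UNIV. c i powi pos_part (exch S $ i $ j))" for j
      using is_seedD(4)[OF S] is_seedD(4)[OF T] prod_nz[OF c] by (simp add: d_def)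
    have minus: "coefm T j = coefm S j / d j * (\<Prod>i\<in>UNIV. c i powi pos_part (- exch S $ i $ j))" for j
    proof -
      let ?X = "\<Prod>i\<in>UNIV. clus S i powi (exch S $ i $ j)" and ?C = "\<Prod>i\<in>UNIV. c i powi (exch S $ i $ j)"
      have "hatted S j = hatted T j"
        using L by (simp add: seed_equiv_def)
      then have "coefp S j / coefm S j * ?X = coefp T j / coefm T j * (?X / ?C)"
        unfolding hatted_T[OF B x] hatted_def[of S] .
      moreover have "?X \<noteq> 0"
        using is_seedD(1)[OF S] by simp
      ultimately have "coefp S j * (coefm T j * ?C) = coefp T j * coefm S j"
        using prod_nz[OF c] is_seedD(5)[OF S] is_seedD(5)[OF T] by (simp add: divide_simps mult_ac)
      also have "\<dots> = coefp S j * (coefm S j / d j * (\<Prod>i\<in>UNIV. c i powi pos_part (- exch S $ i $ j)) * ?C)"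
        unfolding plus prod_powi_pos_part[OF c, where b = "\<lambda>i. exch S $ i $ j"] by simp
      finally show ?thesis
        by (simp only: mult_cancel_left mult_cancel_right is_seedD(4)[OF S] prod_nz[OF c] simp_thms)
    qed
    show ?R
      using c d x plus minus by blast
  next
    assume "exch S = exch T \<and> ?R"
    then obtain c d where B: "exch S = exch T" and c: "\<And>j. c j \<in> P" and d: "\<And>j. d j \<in> P"
      and x: "\<And>j. clus T j = clus S j / c j"
      and p: "\<And>j. coefp T j = coefp S j / d j * (\<Prod>i\<in>UNIV. c i powi pos_part (exch S $ i $ j))"
        "\<And>j. coefm T j = coefm S j / d j * (\<Prod>i\<in>UNIV. c i powi pos_part (- exch S $ i $ j))"
      by blast
    have "hatted S j = hatted T j" for j
      unfolding hatted_T[OF B x] p prod_powi_pos_part[OF c, where b = "\<lambda>i. exch S $ i $ j"]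
      using P_nonzero[OF c] P_nonzero[OF d] by (simp add: hatted_def)
    moreover have "asymp_eq P (clus S i) (clus T i)" for i
      using c P_nonzero[OF c] is_seedD(1)[OF S] by (simp add: asymp_eq_def x)
    ultimately show ?L
      using B by (simp add: seed_equiv_def fun_eq_iff)
  qed
qed

end

theorem proposition2p3:
  fixes P :: "'f::field_char_0 set"
    and S S' :: "('f, 'n::finite) seed"
  assumes "CARD('n) \<ge> 2"
    and "ambient_field P TYPE('n)"
    and "is_seed P S"
    and "is_seed P S'"
  shows
    "(seed_sim P S S' \<longleftrightarrow>
        exch S = exch S' \<and> hatted S = hatted S' \<and> (\<forall>i. asymp_eq P (clus S i) (clus S' i)))
     \<and>
     (seed_sim P S S' \<longleftrightarrow>
        exch S = exch S' \<and>
        (\<exists>c d :: 'n \<Rightarrow> 'f. (\<forall>j. c j \<in> P \<and> d j \<in> P) \<and>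
           (\<forall>j. clus S' j = clus S j / c j \<and>
              coefp S' j = coefp S j / d j * (\<Prod>i\<in>UNIV. c i powi pos_part (exch S $ i $ j)) \<and>
              coefm S' j = coefm S j / d j * (\<Prod>i\<in>UNIV. c i powi pos_part (- exch S $ i $ j)))))"
proof -
  interpret coefficients P
    by unfold_locales (use assms(2) in \<open>simp add: ambient_field_def\<close>)
  have "seed_sim P S S' \<longleftrightarrow> seed_equiv P S S'"
    using seed_sim_imp_equiv seed_equiv_imp_sim[OF assms(1,3,4)] by blast
  then show ?thesis
    using seed_equiv_iff_rescaling[OF assms(3,4)] unfolding seed_equiv_def by blast
qed

end
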